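(* Suppose $p(a,x)\in\mathbb R\langle a,x\rangle$ is symmetric. If $p$ is (globally) convex in $x$ and (globally) concave in $a$, then there exist finitely many linear (homogeneous of degree one) polynomials $r_j(x)$ in $x$ and $s_\ell(a)$ in $a$, and a polynomial $L(a,x)$ which has degree at most one in $x$ and degree at most one in $a$ (so joint degree at most two), such that $$p(a,x)=L(a,x)+R(x)^TR(x)-S(a)^TS(a),$$ where $R(x)$ is the column vector with entries $r_j(x)$ and $S(a)$ is the column vector with entries $s_\ell(a)$.
   Context: Fix a positive integer $g$. $\mathbb R\langle a,x\rangle$ denotes the polynomials with real coefficients in the non-commuting variables $a=(a_1,\dots,a_g)$, $x=(x_1,\dots,x_g)$. The involution ${}^T$ on $\mathbb R\langle a,x\rangle$ is linear, reverses the order of words, and fixes each variable; $p$ is symmetric if $p^T=p$. For a column vector $R$ of polynomials $r_j$, $R^TR=\sum_j r_j^Tr_j$. $\mathbb S_n(\mathbb R^g)$ is the set of $g$-tuples of real symmetric $n\times n$ matrices, and polynomials are evaluated at $(A,X)$ with $A,X\in\mathbb S_n(\mathbb R^g)$ by substitution. $P\succeq Q$ means $P-Q$ is symmetric positive semidefinite. $p$ is convex in $x$ if $tp(A,X)+(1-t)p(A,Y)\succeq p(A,tX+(1-t)Y)$ for all $n$, all $A,X,Y\in\mathbb S_n(\mathbb R^g)$ and all $0<t<1$. $p$ is concave in $a$ if $p(tA+(1-t)B,X)\succeq tp(A,X)+(1-t)p(B,X)$ for all $n$, all $A,B,X\in\mathbb S_n(\mathbb R^g)$ and all $0<t<1$.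 *)

theory Defs
  imports
    "HOL-Library.Poly_Mapping"
    "Jordan_Normal_Form.Matrix"
begin

text \<open>
  Words carry the concatenation monoid in additive notation, because the convolution
  product of \<^type>\<open>poly_mapping\<close> is defined over an additive monoid of exponents.
  The wrapper type avoids a global instance on \<^type>\<open>list\<close>.
\<close>

datatype 'v word = Word (letters: "'v list")

instantiation word :: (type) monoid_add
begin

definition zero_word :: "'a word" where
  "0 = Word []"

definition plus_word :: "'a word \<Rightarrow> 'a word \<Rightarrow> 'a word" where
  "u + v = Word (letters u @ letters v)"

instance
  by standard (simp_all add: zero_word_def plus_word_def)

end

datatype 'g var = AVar 'g | XVar 'g

text \<open>
  The free algebra on the letters \<open>AVar i\<close>, \<open>XVar i\<close>; the number of letters of
  each kind is the (automatically positive) cardinality of the finite type \<open>'g\<close>.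
\<close>

type_synonym 'g ncpoly = "'g var word \<Rightarrow>\<^sub>0 real"

fun rev_word :: "'v word \<Rightarrow> 'v word" where
  "rev_word (Word vs) = Word (rev vs)"

lemma rev_word_rev_word [simp]: "rev_word (rev_word w) = w"
  by (cases w) simp

lemma inj_rev_word: "inj rev_word"
  by (metis injI rev_word_rev_word)

text \<open>
  \<^const>\<open>Poly_Mapping.map_key\<close> precomposes with an injective function; since
  \<^const>\<open>rev_word\<close> is an involution, this sends the monomial \<open>w\<close> to \<open>rev_word w\<close>.
\<close>

definition nc_transpose :: "'g ncpoly \<Rightarrow> 'g ncpoly" where
  "nc_transpose p = Poly_Mapping.map_key rev_word p"

lemma lookup_nc_transpose: "Poly_Mapping.lookup (nc_transpose p) w = Poly_Mapping.lookup p (rev_word w)"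
  by (simp add: nc_transpose_def map_key.rep_eq[OF inj_rev_word])

definition nc_symmetric :: "'g ncpoly \<Rightarrow> bool" where
  "nc_symmetric p \<longleftrightarrow> nc_transpose p = p"

definition is_a :: "'g var \<Rightarrow> bool" where
  "is_a v \<longleftrightarrow> (\<exists>i. v = AVar i)"

definition is_x :: "'g var \<Rightarrow> bool" where
  "is_x v \<longleftrightarrow> (\<exists>i. v = XVar i)"

text \<open>
  Degree in the letters satisfying \<open>V\<close>; the zero polynomial gets degree 0.
\<close>

definition degree_in :: "('g var \<Rightarrow> bool) \<Rightarrow> 'g ncpoly \<Rightarrow> nat" where
  "degree_in V p = Max (insert 0 ((\<lambda>w. length (filter V (letters w))) ` Poly_Mapping.keys p))"

text \<open>
  Homogeneous of degree one in the letters satisfying \<open>V\<close>, with no other letters;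
  as usual the zero polynomial is included.
\<close>

definition linear_in :: "('g var \<Rightarrow> bool) \<Rightarrow> 'g ncpoly \<Rightarrow> bool" where
  "linear_in V p \<longleftrightarrow> (\<forall>w\<in>Poly_Mapping.keys p. \<exists>v. V v \<and> w = Word [v])"

text \<open>The product \<open>R\<^sup>T R\<close> for a column vector \<open>R\<close> given by the list of its entries.\<close>

definition nc_gram :: "'g ncpoly list \<Rightarrow> 'g ncpoly" where
  "nc_gram R = (\<Sum>r\<leftarrow>R. nc_transpose r * r)"

definition sym_tuple :: "nat \<Rightarrow> ('g \<Rightarrow> real mat) \<Rightarrow> bool" where
  "sym_tuple n X \<longleftrightarrow> (\<forall>i. X i \<in> carrier_mat n n \<and> transpose_mat (X i) = X i)"

definition eval_word :: "nat \<Rightarrow> ('g \<Rightarrow> real mat) \<Rightarrow> ('g \<Rightarrow> real mat) \<Rightarrow> 'g var word \<Rightarrow> real mat" where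
  "eval_word n A X w =
     foldr (\<lambda>v M. (case v of AVar i \<Rightarrow> A i | XVar i \<Rightarrow> X i) * M) (letters w) (1\<^sub>m n)"

text \<open>
  The linear combination of the word values is formed entrywise, since
  \<^typ>\<open>real mat\<close> is not a \<^class>\<open>comm_monoid_add\<close>.
\<close>

definition eval_nc :: "nat \<Rightarrow> 'g ncpoly \<Rightarrow> ('g \<Rightarrow> real mat) \<Rightarrow> ('g \<Rightarrow> real mat) \<Rightarrow> real mat" where
  "eval_nc n p A X =
     mat n n (\<lambda>(i, j). \<Sum>w\<in>Poly_Mapping.keys p. Poly_Mapping.lookup p w * (eval_word n A X w $$ (i, j)))"

definition pos_semidef :: "nat \<Rightarrow> real mat \<Rightarrow> bool" where
  "pos_semidef n M \<longleftrightarrow>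
     M \<in> carrier_mat n n \<and> transpose_mat M = M \<and>
     (\<forall>v\<in>carrier_vec n. 0 \<le> v \<bullet> (M *\<^sub>v v))"

definition mat_ge :: "nat \<Rightarrow> real mat \<Rightarrow> real mat \<Rightarrow> bool" where
  "mat_ge n P Q \<longleftrightarrow> pos_semidef n (P - Q)"

definition tuple_comb :: "real \<Rightarrow> ('g \<Rightarrow> real mat) \<Rightarrow> ('g \<Rightarrow> real mat) \<Rightarrow> 'g \<Rightarrow> real mat" where
  "tuple_comb t X Y = (\<lambda>i. t \<cdot>\<^sub>m X i + (1 - t) \<cdot>\<^sub>m Y i)"

definition convex_in_x :: "'g ncpoly \<Rightarrow> bool" where
  "convex_in_x p \<longleftrightarrow>
     (\<forall>n A X Y t. sym_tuple n A \<longrightarrow> sym_tuple n X \<longrightarrow> sym_tuple n Y \<longrightarrow> 0 < t \<longrightarrow> t < 1 \<longrightarrow>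
        mat_ge n (t \<cdot>\<^sub>m eval_nc n p A X + (1 - t) \<cdot>\<^sub>m eval_nc n p A Y)
                 (eval_nc n p A (tuple_comb t X Y)))"

definition concave_in_a :: "'g ncpoly \<Rightarrow> bool" where
  "concave_in_a p \<longleftrightarrow>
     (\<forall>n A B X t. sym_tuple n A \<longrightarrow> sym_tuple n B \<longrightarrow> sym_tuple n X \<longrightarrow> 0 < t \<longrightarrow> t < 1 \<longrightarrow>
        mat_ge n (eval_nc n p (tuple_comb t A B) X)
                 (t \<cdot>\<^sub>m eval_nc n p A X + (1 - t) \<cdot>\<^sub>m eval_nc n p B X))"

end

theory Submission
  imports Defs "HOL-Computational_Algebra.Polynomial"
begin

text \<open>
  Convexity in \<open>x\<close> is used through the second derivative of \<open>p\<close> in a direction \<open>H\<close> on the \<open>x\<close>-letters,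
  which is twice the sum of \<open>c(\<alpha>\<^sup>T x\<^sub>i u x\<^sub>j \<beta>) \<alpha>\<^sup>T H\<^sub>i u H\<^sub>j \<beta>\<close> over all ways of marking two \<open>x\<close>-letters in
  the words of \<open>p\<close>; here \<open>c(w)\<close> is the coefficient of \<open>w\<close>. On a direct sum of two spaces, evaluate at a
  block diagonal point and choose \<open>H\<close> off-diagonal, so that the outer words \<open>\<alpha>\<close>, \<open>\<beta>\<close> act on the first
  summand and the middle word \<open>u\<close> on the second. If the first summand is a tree on which words are
  linearly independent, the vectors \<open>f\<^sub>j\<^sub>\<beta>\<close>, the values of \<open>H\<^sub>j \<beta>\<close> at the root, can be prescribed at
  will. Convexity therefore says that the middle matrix, with rows and columns indexed by pairs of an
  \<open>x\<close>-letter and a word and with entries \<open>\<Sum>\<^sub>u c(\<alpha>\<^sup>T x\<^sub>i u x\<^sub>j \<beta>) u\<close>, is positive semidefinite at every tuple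
  of symmetric matrices (\<open>middle_matrix_nonneg\<close>). As for scalar matrices, a vanishing diagonal entry
  kills its row; here this holds coefficient by coefficient (\<open>middle_matrix_row_zero\<close>).

  The rest is counting letters. Suppose that a word with the largest number \<open>d \<ge> 3\<close> of \<open>x\<close>-letters occurs
  in \<open>p\<close>, and mark its last two \<open>x\<close>-letters. The prefix has \<open>d - 2\<close> of them, so the words of the diagonal
  entry of its row would have at least \<open>2 (d - 2) + 2 > d\<close> of them. Thus that entry and the row vanish, a
  contradiction. So \<open>p\<close> has degree at most two in \<open>x\<close>, and by concavity also in \<open>a\<close>.

  Now mark the two \<open>x\<close>-letters of a word of degree two in \<open>x\<close>. If letters preceded the first one, the
  degree bounds would leave at most a coefficient \<open>c(a\<^sub>k x\<^sub>i x\<^sub>i a\<^sub>k)\<close> in the diagonal entry of the row.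
  It is nonnegative by convexity in \<open>x\<close>, and
  nonpositive by concavity in \<open>a\<close>, because it is the leading coefficient of
  \<open>s \<mapsto> \<Sum>\<^sub>n c(a\<^sub>k x\<^sub>i\<^sup>n a\<^sub>k) s\<^sup>n\<close>. Hence the word starts and ends with its \<open>x\<close>-letters. Likewise a word of
  degree two in \<open>a\<close> starts and ends with its \<open>a\<close>-letters, so no word has degree two in both. There
  remain words \<open>x\<^sub>i x\<^sub>j\<close> and \<open>x\<^sub>i a\<^sub>k x\<^sub>j\<close>. The latter would make a nonnegative quadratic form depend
  linearly on a free real parameter. What is left in degree two is a nonnegative quadratic form in
  the \<open>x\<close>-letters with real coefficients, hence a sum of squares; with the opposite sign the same
  holds for \<open>a\<close>. All other words have degree at most one in \<open>x\<close> and in \<open>a\<close>.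

  Throughout, matrices appear as kernels \<open>K v r s\<close> on a finite index set, one for each letter \<open>v\<close>. This
  permits index sets made of words and disjoint sums; numbering the index set gives matrices back.
\<close>

section \<open>Words acting through symmetric kernels\<close>

text \<open>
  The scalars are an arbitrary commutative ring because perturbed kernels are treated as kernels
  with polynomial entries.
\<close>

fun act :: "'b set \<Rightarrow> ('v \<Rightarrow> 'b \<Rightarrow> 'b \<Rightarrow> 'r::comm_ring_1) \<Rightarrow> 'v list \<Rightarrow> ('b \<Rightarrow> 'r) \<Rightarrow> 'b \<Rightarrow> 'r" where
  "act I K [] f = f"
| "act I K (v # w) f = (\<lambda>r. \<Sum>s\<in>I. K v r s * act I K w f s)"

definition ip :: "'b set \<Rightarrow> ('b \<Rightarrow> real) \<Rightarrow> ('b \<Rightarrow> real) \<Rightarrow> real" where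
  "ip I f g = (\<Sum>r\<in>I. f r * g r)"

definition symmetric_kernel :: "('v \<Rightarrow> 'b \<Rightarrow> 'b \<Rightarrow> real) \<Rightarrow> bool" where
  "symmetric_kernel K \<longleftrightarrow> (\<forall>v r s. K v r s = K v s r)"

definition words :: "nat \<Rightarrow> 'v list set" where
  "words N = {w. length w \<le> N}"

lemma finite_words [simp]: "finite (words N :: 'v::finite list set)"
  unfolding words_def using finite_lists_length_le[of "UNIV :: 'v set" N] by simp

lemma act_append: "act I K (u @ w) f = act I K u (act I K w f)"
  by (induction u) auto

lemma act_zero [simp]: "act I K w (\<lambda>_. 0) = (\<lambda>_. 0)"
  by (induction w) auto

lemma ip_commute: "ip I f g = ip I g f"
  by (simp add: ip_def mult.commute)

lemma ip_act_letter:
  assumes "symmetric_kernel K"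
  shows "ip I f (act I K [v] g) = ip I (act I K [v] f) g"
proof -
  have "ip I f (act I K [v] g) = (\<Sum>r\<in>I. \<Sum>s\<in>I. f r * K v r s * g s)"
    by (simp add: ip_def sum_distrib_left mult_ac)
  also have "\<dots> = (\<Sum>s\<in>I. \<Sum>r\<in>I. f r * K v r s * g s)"
    by (rule sum.swap)
  also have "\<dots> = (\<Sum>s\<in>I. \<Sum>r\<in>I. K v s r * f r * g s)"
    using assms by (intro sum.cong refl) (simp add: symmetric_kernel_def mult_ac)
  also have "\<dots> = ip I (act I K [v] f) g"
    by (simp add: ip_def sum_distrib_right)
  finally show ?thesis .
qed

lemma ip_act:
  assumes "symmetric_kernel K"
  shows "ip I f (act I K w g) = ip I (act I K (rev w) f) g"
proof (induction w arbitrary: f)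
  case (Cons v w)
  have "ip I f (act I K (v # w) g) = ip I f (act I K [v] (act I K w g))"
    by simp
  also have "\<dots> = ip I (act I K (rev w) (act I K [v] f)) g"
    using ip_act_letter[OF assms] Cons.IH by metis
  also have "\<dots> = ip I (act I K (rev (v # w)) f) g"
    by (simp only: rev.simps act_append)
  finally show ?case .
qed simp

section \<open>A tree on which words are independent\<close>

text \<open>
  The letter \<open>v\<close> acts on the free monoid as the sum of the creation operator \<open>s \<mapsto> v s\<close> and its
  adjoint; on words of bounded length this is a truncated Fock space.
\<close>

definition tree :: "'v \<Rightarrow> 'v list \<Rightarrow> 'v list \<Rightarrow> real" where
  "tree v r s = (if r = v # s \<or> s = v # r then 1 else 0)"

definition root_vec :: "'v list \<Rightarrow> real" where
  "root_vec r = (if r = [] then 1 else 0)"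

lemma symmetric_tree: "symmetric_kernel tree"
  by (auto simp: symmetric_kernel_def tree_def)

text \<open>
  A word of length \<open>n\<close> moves the root by at most \<open>n\<close> levels, and reaches level \<open>n\<close> only if every letter
  creates. The values of words at the root are thus triangular with respect to length.
\<close>

lemma act_tree_root:
  fixes w :: "'v::finite list"
  assumes "length w \<le> length r" "length r \<le> N"
  shows "act (words N) tree w root_vec r = (if r = w then 1 else 0)"
  using assms
proof (induction w arbitrary: r)
  case (Cons v w)
  from Cons.prems obtain v' r' where r: "r = v' # r'" by (cases r) auto
  have *: "tree v r s * act (words N) tree w root_vec s = (if s = r' then (if r = v # w then 1 else 0) else 0)"
    if "s \<in> words N" for s
  proof (cases "tree v r s = 0")
    case True
    then show ?thesis by (auto simp: r tree_def split: if_splits)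
  next
    case False
    then have s: "r = v # s \<or> s = v # r" by (auto simp: tree_def split: if_splits)
    then have "length w \<le> length s" "length s \<le> N" using Cons.prems that by (auto simp: words_def)
    then have "act (words N) tree w root_vec s = (if s = w then 1 else 0)" by (rule Cons.IH)
    then show ?thesis using s Cons.prems by (auto simp: r tree_def)
  qed
  have "r' \<in> words N" using Cons.prems by (simp add: r words_def)
  then show ?case by (simp add: * sum.delta)
qed (simp add: root_vec_def)

text \<open>
  Inverting the triangular system: \<open>g u\<close> is the basis vector of \<open>u\<close>, corrected by the dual vectors of
  all longer words.
\<close>

lemma dual_vectors:
  "\<exists>g :: 'v::finite list \<Rightarrow> 'v list \<Rightarrow> real. \<forall>u\<in>words N. \<forall>w\<in>words N.
     ip (words N) (g u) (act (words N) tree w root_vec) = (if u = w then 1 else 0)"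
proof -
  let ?I = "words N :: 'v list set"
  let ?e = "\<lambda>w. act ?I tree w root_vec"
  have "\<exists>g. \<forall>w\<in>words N. ip ?I g (?e w) = (if u = w then 1 else 0)" if "u \<in> words N" for u
    using that
  proof (induction "N - length u" arbitrary: u rule: less_induct)
    case less
    let ?U = "{u' \<in> words N. length u < length u'}"
    have "\<forall>u'\<in>?U. \<exists>g. \<forall>w\<in>words N. ip ?I g (?e w) = (if u' = w then 1 else 0)"
    proof
      fix u' :: "'v list" assume "u' \<in> ?U"
      then have "u' \<in> words N" "N - length u' < N - length u" by (auto simp: words_def)
      then show "\<exists>g. \<forall>w\<in>words N. ip ?I g (?e w) = (if u' = w then 1 else 0)"
        using less.hyps by blast
    qed
    then obtain G where G: "\<And>u' w. u' \<in> ?U \<Longrightarrow> w \<in> words N \<Longrightarrow> ip ?I (G u') (?e w) = (if u' = w then 1 else 0)"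
      by metis
    define g where "g r = (if r = u then 1 else 0) - (\<Sum>u'\<in>?U. ?e u' u * G u' r)" for r
    have "ip ?I g (?e w) = (if u = w then 1 else 0)" if w: "w \<in> words N" for w
    proof -
      have "ip ?I g (?e w) = ?e w u - (\<Sum>r\<in>?I. (\<Sum>u'\<in>?U. ?e u' u * G u' r) * ?e w r)"
        using less.prems
        by (simp add: ip_def g_def left_diff_distrib sum_subtractf if_distrib[where f="\<lambda>x. x * _"] sum.delta cong: if_cong)
      also have "(\<Sum>r\<in>?I. (\<Sum>u'\<in>?U. ?e u' u * G u' r) * ?e w r) = (\<Sum>u'\<in>?U. ?e u' u * ip ?I (G u') (?e w))"
        unfolding ip_def sum_distrib_left sum_distrib_right by (subst sum.swap) (simp add: mult_ac)
      also have "\<dots> = (\<Sum>u'\<in>?U. if u' = w then ?e w u else 0)"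
        by (rule sum.cong) (auto simp: G w)
      also have "\<dots> = (if length u < length w then ?e w u else 0)"
        using w by (simp add: sum.delta)
      finally show ?thesis
        using less.prems act_tree_root[of w u N] by (auto simp: words_def not_less)
    qed
    then show ?case by blast
  qed
  then show ?thesis by (intro bchoice ballI)
qed

section \<open>The second derivative of a noncommutative form\<close>

lemma coeff_2_nonneg_of_midpoint:
  fixes P :: "real poly"
  assumes "\<And>x. 2 * poly P 0 \<le> poly P x + poly P (- x)"
  shows "0 \<le> coeff P 2"
proof -
  obtain a P1 where P1: "P = pCons a P1" by (cases P)
  obtain b P2 where P2: "P1 = pCons b P2" by (cases P1)
  have "0 \<le> poly P2 x + poly P2 (- x)" if "x \<noteq> 0" for x
  proof -
    have "0 \<le> x * x * (poly P2 x + poly P2 (- x))"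
      using assms[of x] by (simp add: P1 P2 algebra_simps)
    moreover have "0 < x * x" using that by (simp add: zero_less_mult_iff) linarith
    ultimately show ?thesis by (simp add: zero_le_mult_iff)
  qed
  then have "\<forall>\<^sub>F x in at 0. 0 \<le> poly P2 x + poly P2 (- x)"
    by (simp add: eventually_at_filter)
  moreover have "((\<lambda>x. poly P2 x + poly P2 (- x)) \<longlongrightarrow> poly P2 0 + poly P2 (- 0)) (at 0)"
    by (intro tendsto_intros)
  ultimately have "0 \<le> poly P2 0 + poly P2 (- 0)"
    by (intro tendsto_lowerbound[where F="at (0::real)"]) auto
  then show ?thesis by (simp add: P1 P2 poly_0_coeff_0 numeral_2_eq_2)
qed

text \<open>
  The ways of marking one letter, respectively two letters, of a word; they index the terms of
  order one and two in the expansion of the word at \<open>K + x H\<close>.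
\<close>

definition splits1 :: "'v list \<Rightarrow> ('v list \<times> 'v \<times> 'v list) set" where
  "splits1 w = {(u, j, \<beta>). w = u @ j # \<beta>}"

definition splits2 :: "'v list \<Rightarrow> ('v list \<times> 'v \<times> 'v list \<times> 'v \<times> 'v list) set" where
  "splits2 w = {(\<alpha>, i, u, j, \<beta>). w = \<alpha> @ i # u @ j # \<beta>}"

lemma splits1_Nil [simp]: "splits1 [] = {}"
  by (simp add: splits1_def)

lemma splits2_Nil [simp]: "splits2 [] = {}"
  by (simp add: splits2_def)

lemma splits1_Cons: "splits1 (v # w) = insert ([], v, w) ((\<lambda>(u, j, \<beta>). (v # u, j, \<beta>)) ` splits1 w)"
  by (auto simp: splits1_def image_iff Cons_eq_append_conv)

lemma splits2_Cons:
  "splits2 (v # w) = (\<lambda>s. ([], v, s)) ` splits1 w \<union> (\<lambda>(\<alpha>, t). (v # \<alpha>, t)) ` splits2 w"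
  by (auto simp: splits1_def splits2_def image_iff Cons_eq_append_conv)

lemma finite_splits1 [simp]: "finite (splits1 w)"
  by (induction w) (auto simp: splits1_Cons)

lemma finite_splits2 [simp]: "finite (splits2 w)"
  by (induction w) (auto simp: splits2_Cons)

text \<open>
  The kernel \<open>K + x H\<close> with a formal parameter \<open>x\<close>, so that derivatives in the direction \<open>H\<close> are,
  up to factorials, coefficients of a polynomial.
\<close>

definition pencil :: "('v \<Rightarrow> 'b \<Rightarrow> 'b \<Rightarrow> real) \<Rightarrow> ('v \<Rightarrow> 'b \<Rightarrow> 'b \<Rightarrow> real) \<Rightarrow> 'v \<Rightarrow> 'b \<Rightarrow> 'b \<Rightarrow> real poly" where
  "pencil K H v r s = [:K v r s, H v r s:]"

lemma poly_act_pencil: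
  "poly (act I (pencil K H) w (\<lambda>r. [:f r:]) r) x = act I (\<lambda>v r s. K v r s + x * H v r s) w f r"
  by (induction w arbitrary: r) (auto simp: poly_sum pencil_def algebra_simps)

lemma coeff_act_pencil_0: "coeff (act I (pencil K H) w (\<lambda>r. [:f r:]) r) 0 = act I K w f r"
  using poly_act_pencil[of I K H w f r 0] by (simp add: poly_0_coeff_0)

lemma coeff_act_pencil_Suc:
  "coeff (act I (pencil K H) (v # w) f r) (Suc m) =
     (\<Sum>s\<in>I. K v r s * coeff (act I (pencil K H) w f s) (Suc m)) +
     (\<Sum>s\<in>I. H v r s * coeff (act I (pencil K H) w f s) m)"
  by (simp add: coeff_sum pencil_def sum.distrib)

lemma coeff_act_pencil_1:
  "coeff (act I (pencil K H) w (\<lambda>r. [:f r:]) r) (Suc 0) =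
     (\<Sum>(u, j, \<beta>)\<in>splits1 w. act I K u (act I H [j] (act I K \<beta> f)) r)"
proof (induction w arbitrary: r)
  case (Cons v w)
  have "([], v, w) \<notin> (\<lambda>(u, j, \<beta>). (v # u, j, \<beta>)) ` splits1 w" by auto
  moreover have "inj_on (\<lambda>(u, j, \<beta>). (v # u, j, \<beta>)) (splits1 w)"
    by (auto simp: inj_on_def)
  ultimately have "(\<Sum>(u, j, \<beta>)\<in>splits1 (v # w). act I K u (act I H [j] (act I K \<beta> f)) r) =
      act I H [v] (act I K w f) r +
      (\<Sum>(u, j, \<beta>)\<in>splits1 w. \<Sum>s\<in>I. K v r s * act I K u (act I H [j] (act I K \<beta> f)) s)"
    by (simp add: splits1_Cons sum.reindex case_prod_unfold)
  also have "(\<Sum>(u, j, \<beta>)\<in>splits1 w. \<Sum>s\<in>I. K v r s * act I K u (act I H [j] (act I K \<beta> f)) s) =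
      (\<Sum>s\<in>I. K v r s * (\<Sum>(u, j, \<beta>)\<in>splits1 w. act I K u (act I H [j] (act I K \<beta> f)) s))"
    unfolding case_prod_unfold sum_distrib_left by (rule sum.swap)
  finally show ?case
    by (simp only: coeff_act_pencil_Suc Cons.IH coeff_act_pencil_0) simp
qed simp

lemma coeff_act_pencil_2:
  fixes w :: "'v list"
  shows "coeff (act I (pencil K H) w (\<lambda>r. [:f r:]) r) 2 =
     (\<Sum>(\<alpha>, i, u, j, \<beta>)\<in>splits2 w. act I K \<alpha> (act I H [i] (act I K u (act I H [j] (act I K \<beta> f)))) r)"
  unfolding numeral_2_eq_2
proof (induction w arbitrary: r)
  case (Cons v w)
  let ?t = "\<lambda>\<alpha> i u j \<beta>. act I K \<alpha> (act I H [i] (act I K u (act I H [j] (act I K \<beta> f))))"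
  have "(\<lambda>s. ([], v, s)) ` splits1 w \<inter> (\<lambda>(\<alpha>, t). (v # \<alpha>, t)) ` splits2 w = {}" by auto
  moreover have "inj_on (\<lambda>(\<alpha>, t). (v # \<alpha>, t)) (splits2 w)" "inj_on (\<lambda>s. ([] :: 'v list, v, s)) (splits1 w)"
    by (auto simp: inj_on_def)
  ultimately have "(\<Sum>(\<alpha>, i, u, j, \<beta>)\<in>splits2 (v # w). ?t \<alpha> i u j \<beta> r) =
      (\<Sum>(u, j, \<beta>)\<in>splits1 w. \<Sum>s\<in>I. H v r s * act I K u (act I H [j] (act I K \<beta> f)) s) +
      (\<Sum>(\<alpha>, i, u, j, \<beta>)\<in>splits2 w. \<Sum>s\<in>I. K v r s * ?t \<alpha> i u j \<beta> s)"
    by (simp add: splits2_Cons sum.union_disjoint sum.reindex case_prod_unfold)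
  also have "(\<Sum>(u, j, \<beta>)\<in>splits1 w. \<Sum>s\<in>I. H v r s * act I K u (act I H [j] (act I K \<beta> f)) s) =
      (\<Sum>s\<in>I. H v r s * (\<Sum>(u, j, \<beta>)\<in>splits1 w. act I K u (act I H [j] (act I K \<beta> f)) s))"
    unfolding case_prod_unfold sum_distrib_left by (rule sum.swap)
  also have "(\<Sum>(\<alpha>, i, u, j, \<beta>)\<in>splits2 w. \<Sum>s\<in>I. K v r s * ?t \<alpha> i u j \<beta> s) =
      (\<Sum>s\<in>I. K v r s * (\<Sum>(\<alpha>, i, u, j, \<beta>)\<in>splits2 w. ?t \<alpha> i u j \<beta> s))"
    unfolding case_prod_unfold sum_distrib_left by (rule sum.swap)
  finally show ?case
    by (simp only: coeff_act_pencil_Suc Cons.IH coeff_act_pencil_1)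
qed simp

section \<open>Convexity and the middle matrix\<close>

definition form :: "'b set \<Rightarrow> ('v list \<Rightarrow> real) \<Rightarrow> ('v \<Rightarrow> 'b \<Rightarrow> 'b \<Rightarrow> real) \<Rightarrow> ('b \<Rightarrow> real) \<Rightarrow> real" where
  "form I c K f = (\<Sum>w | c w \<noteq> 0. c w * ip I f (act I K w f))"

lemma act_bij:
  assumes "bij_betw h J I" "r \<in> J"
  shows "act J (\<lambda>v a b. K v (h a) (h b)) w (f \<circ> h) r = act I K w f (h r)"
  using assms(2)
proof (induction w arbitrary: r)
  case (Cons v w)
  have "act J (\<lambda>v a b. K v (h a) (h b)) (v # w) (f \<circ> h) r = (\<Sum>s\<in>J. K v (h r) (h s) * act I K w f (h s))"
    unfolding act.simps by (rule sum.cong[OF refl]) (simp only: Cons.IH)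
  also have "\<dots> = act I K (v # w) f (h r)"
    using sum.reindex_bij_betw[OF assms(1), of "\<lambda>s. K v (h r) s * act I K w f s"] by simp
  finally show ?case .
qed simp

lemma form_bij:
  assumes "bij_betw h J I"
  shows "form J c (\<lambda>v a b. K v (h a) (h b)) (f \<circ> h) = form I c K f"
proof -
  have "ip J (f \<circ> h) (act J (\<lambda>v a b. K v (h a) (h b)) w (f \<circ> h)) = ip I f (act I K w f)" for w
    using sum.reindex_bij_betw[OF assms, of "\<lambda>r. f r * act I K w f r"] act_bij[OF assms, of _ K w f]
    by (simp add: ip_def)
  then show ?thesis by (simp add: form_def)
qed

text \<open>
  A polynomial is represented by its coefficient function on words.
\<close>

definition symmetric_coeffs :: "('v list \<Rightarrow> real) \<Rightarrow> bool" where
  "symmetric_coeffs c \<longleftrightarrow> finite {w. c w \<noteq> 0} \<and> (\<forall>w. c (rev w) = c w)"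

text \<open>
  Midpoint convexity in the letters satisfying \<open>V\<close>, at the centre \<open>K\<close> of the segment from \<open>K - H\<close> to
  \<open>K + H\<close>. Index sets \<open>{..<n}\<close> suffice, as \<open>midpoint_convex_inD\<close> transports this to every finite set.
\<close>

definition midpoint_convex_in :: "('v \<Rightarrow> bool) \<Rightarrow> ('v list \<Rightarrow> real) \<Rightarrow> bool" where
  "midpoint_convex_in V c \<longleftrightarrow>
     (\<forall>(n :: nat) K H f. symmetric_kernel K \<longrightarrow> symmetric_kernel H \<longrightarrow> (\<forall>v. \<not> V v \<longrightarrow> H v = (\<lambda>_ _. 0)) \<longrightarrow>
        2 * form {..<n} c K f \<le>
          form {..<n} c (\<lambda>v r s. K v r s + H v r s) f + form {..<n} c (\<lambda>v r s. K v r s - H v r s) f)"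

lemma midpoint_convex_inD:
  assumes "midpoint_convex_in V c" "finite I" "symmetric_kernel K" "symmetric_kernel H"
    and "\<And>v. \<not> V v \<Longrightarrow> H v = (\<lambda>_ _. 0)"
  shows "2 * form I c K f \<le>
      form I c (\<lambda>v r s. K v r s + H v r s) f + form I c (\<lambda>v r s. K v r s - H v r s) f"
proof -
  obtain h where h: "bij_betw h {..<card I} I"
    using ex_bij_betw_nat_finite[OF assms(2)] by (auto simp: atLeast0LessThan)
  let ?K = "\<lambda>v a b. K v (h a) (h b)" and ?H = "\<lambda>v a b. H v (h a) (h b)"
  have "symmetric_kernel ?K" "symmetric_kernel ?H" "\<forall>v. \<not> V v \<longrightarrow> ?H v = (\<lambda>_ _. 0)"
    using assms by (auto simp: symmetric_kernel_def)
  then have "2 * form {..<card I} c ?K (f \<circ> h) \<le>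
      form {..<card I} c (\<lambda>v r s. ?K v r s + ?H v r s) (f \<circ> h) + form {..<card I} c (\<lambda>v r s. ?K v r s - ?H v r s) (f \<circ> h)"
    using assms(1) unfolding midpoint_convex_in_def by blast
  then show ?thesis
    using form_bij[OF h, of c K f] form_bij[OF h, of c "\<lambda>v r s. K v r s + H v r s" f]
      form_bij[OF h, of c "\<lambda>v r s. K v r s - H v r s" f] by simp
qed

lemma second_derivative_nonneg:
  assumes "midpoint_convex_in V c" "finite I" "symmetric_kernel K" "symmetric_kernel H"
    and "\<And>v. \<not> V v \<Longrightarrow> H v = (\<lambda>_ _. 0)"
  shows "0 \<le> (\<Sum>w | c w \<noteq> 0. c w * (\<Sum>(\<alpha>, i, u, j, \<beta>)\<in>splits2 w.
      ip I f (act I K \<alpha> (act I H [i] (act I K u (act I H [j] (act I K \<beta> f)))))))"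
proof -
  define P where "P = (\<Sum>w | c w \<noteq> 0. smult (c w) (\<Sum>r\<in>I. smult (f r) (act I (pencil K H) w (\<lambda>r. [:f r:]) r)))"
  have P: "poly P x = form I c (\<lambda>v r s. K v r s + x * H v r s) f" for x
    by (simp add: P_def form_def ip_def poly_sum poly_act_pencil)
  have "2 * poly P 0 \<le> poly P x + poly P (- x)" for x
  proof -
    have "symmetric_kernel (\<lambda>v r s. x * H v r s)" "\<And>v. \<not> V v \<Longrightarrow> (\<lambda>r s. x * H v r s) = (\<lambda>_ _. 0)"
      using assms by (auto simp: symmetric_kernel_def)
    from midpoint_convex_inD[OF assms(1-3) this] show ?thesis by (simp add: P)
  qed
  then have "0 \<le> coeff P 2" by (rule coeff_2_nonneg_of_midpoint)
  also have "coeff P 2 = (\<Sum>w | c w \<noteq> 0. c w * (\<Sum>r\<in>I. f r * (\<Sum>(\<alpha>, i, u, j, \<beta>)\<in>splits2 w.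
      act I K \<alpha> (act I H [i] (act I K u (act I H [j] (act I K \<beta> f)))) r)))"
    by (simp only: P_def coeff_sum coeff_smult coeff_act_pencil_2)
  also have "\<dots> = (\<Sum>w | c w \<noteq> 0. c w * (\<Sum>(\<alpha>, i, u, j, \<beta>)\<in>splits2 w.
      ip I f (act I K \<alpha> (act I H [i] (act I K u (act I H [j] (act I K \<beta> f)))))))"
    unfolding ip_def sum_distrib_left case_prod_unfold by (subst sum.swap) simp
  finally show ?thesis .
qed

definition block_diag :: "('v \<Rightarrow> 'b \<Rightarrow> 'b \<Rightarrow> real) \<Rightarrow> ('v \<Rightarrow> 'c \<Rightarrow> 'c \<Rightarrow> real) \<Rightarrow> 'v \<Rightarrow> 'b + 'c \<Rightarrow> 'b + 'c \<Rightarrow> real" where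
  "block_diag Y Z v r s = (case (r, s) of (Inl a, Inl b) \<Rightarrow> Y v a b | (Inr a, Inr b) \<Rightarrow> Z v a b | _ \<Rightarrow> 0)"

definition block_off :: "('v \<Rightarrow> 'b \<Rightarrow> 'c \<Rightarrow> real) \<Rightarrow> 'v \<Rightarrow> 'b + 'c \<Rightarrow> 'b + 'c \<Rightarrow> real" where
  "block_off G v r s = (case (r, s) of (Inl a, Inr b) \<Rightarrow> G v a b | (Inr b, Inl a) \<Rightarrow> G v a b | _ \<Rightarrow> 0)"

lemma symmetric_block_diag:
  "symmetric_kernel Y \<Longrightarrow> symmetric_kernel Z \<Longrightarrow> symmetric_kernel (block_diag Y Z)"
  by (auto simp: symmetric_kernel_def block_diag_def split: sum.splits)

lemma symmetric_block_off: "symmetric_kernel (block_off G)"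
  by (auto simp: symmetric_kernel_def block_off_def split: sum.splits)

lemma sum_case_Plus:
  "finite I \<Longrightarrow> finite J \<Longrightarrow> (\<Sum>s\<in>I <+> J. \<phi> s) = (\<Sum>a\<in>I. \<phi> (Inl a)) + (\<Sum>b\<in>J. \<phi> (Inr b))"
  by (simp add: sum.Plus comp_def)

lemma act_block_diag:
  assumes "finite I" "finite J"
  shows "act (I <+> J) (block_diag Y Z) w (case_sum f g) = case_sum (act I Y w f) (act J Z w g)"
proof (induction w)
  case (Cons v w)
  then show ?case
    using assms by (auto simp: fun_eq_iff sum_case_Plus block_diag_def split: sum.splits)
qed (auto simp: fun_eq_iff split: sum.splits)

lemma act_block_off:
  assumes "finite I" "finite J"
  shows "act (I <+> J) (block_off G) [j] (case_sum f (\<lambda>_. 0)) = case_sum (\<lambda>_. 0) (\<lambda>b. \<Sum>a\<in>I. G j a b * f a)"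
  using assms by (auto simp: fun_eq_iff sum_case_Plus block_off_def split: sum.splits)

lemma ip_case_sum:
  assumes "finite I" "finite J"
  shows "ip (I <+> J) (case_sum (\<lambda>_. 0) f) (case_sum g g') = ip J f g'"
  using assms by (simp add: ip_def sum_case_Plus)

text \<open>
  The off-diagonal letters \<open>i\<close> and \<open>j\<close> switch between the summands, so \<open>\<alpha>\<close> and \<open>\<beta>\<close> act on the first one
  and \<open>u\<close> on the second. The adjoints of \<open>\<alpha>\<close> and \<open>i\<close> are moved to the left, which reverses \<open>\<alpha>\<close>.
\<close>

lemma ip_block_splitting:
  assumes I: "finite I" "finite J" "symmetric_kernel Y" "symmetric_kernel Z"
  shows "ip (I <+> J) (case_sum e (\<lambda>_. 0)) (act (I <+> J) (block_diag Y Z) \<alpha> (act (I <+> J) (block_off G) [i]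
           (act (I <+> J) (block_diag Y Z) u (act (I <+> J) (block_off G) [j] (act (I <+> J) (block_diag Y Z) \<beta> (case_sum e (\<lambda>_. 0)))))))
       = ip J (\<lambda>b. \<Sum>a\<in>I. G i a b * act I Y (rev \<alpha>) e a) (act J Z u (\<lambda>b. \<Sum>a\<in>I. G j a b * act I Y \<beta> e a))"
  (is "ip ?U ?e (act ?U ?K \<alpha> (act ?U ?H [i] ?y)) = _")
proof -
  have "ip ?U ?e (act ?U ?K \<alpha> (act ?U ?H [i] ?y)) = ip ?U (act ?U ?H [i] (act ?U ?K (rev \<alpha>) ?e)) ?y"
    by (simp only: ip_act[OF symmetric_block_diag[OF I(3,4)], of _ _ \<alpha>] ip_act_letter[OF symmetric_block_off])
  then show ?thesis
    using I by (simp only: act_block_diag act_block_off ip_case_sum act_zero)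
qed

text \<open>
  The quadratic form of the middle matrix, evaluated at \<open>Z\<close> on vectors \<open>f\<close> supported on the index set
  \<open>F\<close>, is half the second derivative at the block sum of the tree and \<open>Z\<close>. The set \<open>U\<close> only has to contain
  the middle words that occur.
\<close>

theorem middle_matrix_nonneg:
  fixes c :: "'v::finite list \<Rightarrow> real" and f :: "'v \<times> 'v list \<Rightarrow> 'c \<Rightarrow> real"
  assumes c: "finite {w. c w \<noteq> 0}" "midpoint_convex_in V c"
    and J: "finite J" "symmetric_kernel Z"
    and F: "finite F" "\<And>i \<alpha>. (i, \<alpha>) \<in> F \<Longrightarrow> V i"
    and U: "finite U" "\<And>i \<alpha> j \<beta> u. (i, \<alpha>) \<in> F \<Longrightarrow> (j, \<beta>) \<in> F \<Longrightarrow> c (rev \<alpha> @ i # u @ j # \<beta>) \<noteq> 0 \<Longrightarrow> u \<in> U"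
  shows "0 \<le> (\<Sum>(i, \<alpha>)\<in>F. \<Sum>(j, \<beta>)\<in>F. \<Sum>u\<in>U.
           c (rev \<alpha> @ i # u @ j # \<beta>) * ip J (f (i, \<alpha>)) (act J Z u (f (j, \<beta>))))"
proof -
  define M where "M = length ` {w. c w \<noteq> 0}"
  define N where "N = Max M"
  have "finite M" using c(1) by (simp add: M_def)
  then have N: "length w \<le> N" if "c w \<noteq> 0" for w
    unfolding N_def by (rule Max_ge) (use that in \<open>auto simp: M_def\<close>)
  obtain g :: "'v list \<Rightarrow> 'v list \<Rightarrow> real" where
    g: "\<forall>u\<in>words N. \<forall>w\<in>words N.
          ip (words N) (g u) (act (words N) tree w root_vec) = (if u = w then 1 else 0)"
    using dual_vectors[of N] by blast
  let ?W = "words N :: 'v list set"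
  let ?a = "\<lambda>\<alpha>. act ?W tree \<alpha> root_vec"
  let ?f = "\<lambda>p b. if p \<in> F then f p b else 0"
  \<comment> \<open>The off-diagonal block sends the value of \<open>\<alpha>\<close> at the root to \<open>f (i, \<alpha>)\<close>.\<close>
  define G where "G i a b = (\<Sum>\<alpha>\<in>?W. ?f (i, \<alpha>) b * g \<alpha> a)" for i a b
  have G: "(\<lambda>b. \<Sum>a\<in>?W. G i a b * ?a \<alpha> a) = ?f (i, \<alpha>)" if "\<alpha> \<in> ?W" for i \<alpha>
  proof
    fix b
    have "(\<Sum>a\<in>?W. G i a b * ?a \<alpha> a) = (\<Sum>\<alpha>'\<in>?W. ?f (i, \<alpha>') b * ip ?W (g \<alpha>') (?a \<alpha>))"
      unfolding G_def ip_def sum_distrib_left sum_distrib_right by (subst sum.swap) (simp add: mult_ac)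
    also have "\<dots> = (\<Sum>\<alpha>'\<in>?W. if \<alpha>' = \<alpha> then ?f (i, \<alpha>) b else 0)"
      by (rule sum.cong) (use that in \<open>auto simp: g\<close>)
    finally show "(\<Sum>a\<in>?W. G i a b * ?a \<alpha> a) = ?f (i, \<alpha>) b" using that by (simp add: sum.delta)
  qed
  have off: "block_off G v = (\<lambda>_ _. 0)" if "\<not> V v" for v
  proof -
    have "G v a b = 0" for a b unfolding G_def using that F(2) by (intro sum.neutral) auto
    then show ?thesis by (auto simp: block_off_def fun_eq_iff split: sum.splits)
  qed
  have "0 \<le> (\<Sum>w | c w \<noteq> 0. c w * (\<Sum>(\<alpha>, i, u, j, \<beta>)\<in>splits2 w.
      ip J (\<lambda>b. \<Sum>a\<in>?W. G i a b * ?a (rev \<alpha>) a) (act J Z u (\<lambda>b. \<Sum>a\<in>?W. G j a b * ?a \<beta> a))))"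
    using second_derivative_nonneg[OF c(2) finite_Plus[OF finite_words[of N] J(1)]
        symmetric_block_diag[OF symmetric_tree J(2)] symmetric_block_off off, where f = "case_sum root_vec (\<lambda>_. 0)"]
    unfolding ip_block_splitting[OF finite_words J(1) symmetric_tree J(2)] .
  also have "\<dots> = (\<Sum>(w, \<alpha>, i, u, j, \<beta>)\<in>(SIGMA w:{w. c w \<noteq> 0}. splits2 w). c w *
      ip J (\<lambda>b. \<Sum>a\<in>?W. G i a b * ?a (rev \<alpha>) a) (act J Z u (\<lambda>b. \<Sum>a\<in>?W. G j a b * ?a \<beta> a)))"
    using c(1) by (simp add: sum_distrib_left case_prod_unfold sum.Sigma)
  also have "\<dots> = (\<Sum>(w, \<alpha>, i, u, j, \<beta>)\<in>(SIGMA w:{w. c w \<noteq> 0}. splits2 w).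
      c w * ip J (?f (i, rev \<alpha>)) (act J Z u (?f (j, \<beta>))))"
  proof (rule sum.cong[OF refl], clarify)
    fix w \<alpha> i u j \<beta> assume "c w \<noteq> 0" "(\<alpha>, i, u, j, \<beta>) \<in> splits2 w"
    then have "rev \<alpha> \<in> ?W" "\<beta> \<in> ?W" using N[of w] by (auto simp: words_def splits2_def)
    then show "c w * ip J (\<lambda>b. \<Sum>a\<in>?W. G i a b * ?a (rev \<alpha>) a) (act J Z u (\<lambda>b. \<Sum>a\<in>?W. G j a b * ?a \<beta> a)) =
        c w * ip J (?f (i, rev \<alpha>)) (act J Z u (?f (j, \<beta>)))"
      by (simp only: G)
  qed
  also have "\<dots> = (\<Sum>((i, \<alpha>), (j, \<beta>), u)\<in>F \<times> F \<times> U.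
           c (rev \<alpha> @ i # u @ j # \<beta>) * ip J (?f (i, \<alpha>)) (act J Z u (?f (j, \<beta>))))"
  proof (rule sum.reindex_bij_witness_not_neutral[where
        S' = "{(w, \<alpha>, i, u, j, \<beta>) | w \<alpha> i u j \<beta>. c w \<noteq> 0 \<and> (\<alpha>, i, u, j, \<beta>) \<in> splits2 w \<and> \<not> ((i, rev \<alpha>) \<in> F \<and> (j, \<beta>) \<in> F)}"
        and T' = "{((i, \<alpha>), (j, \<beta>), u) | i \<alpha> j \<beta> u. (i, \<alpha>) \<in> F \<and> (j, \<beta>) \<in> F \<and> u \<in> U \<and> c (rev \<alpha> @ i # u @ j # \<beta>) = 0}"
        and j = "\<lambda>(w, \<alpha>, i, u, j, \<beta>). ((i, rev \<alpha>), (j, \<beta>), u)"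
        and i = "\<lambda>((i, \<alpha>), (j, \<beta>), u). (rev \<alpha> @ i # u @ j # \<beta>, rev \<alpha>, i, u, j, \<beta>)"])
    show "finite {(w, \<alpha>, i, u, j, \<beta>) | w \<alpha> i u j \<beta>. c w \<noteq> 0 \<and> (\<alpha>, i, u, j, \<beta>) \<in> splits2 w \<and> \<not> ((i, rev \<alpha>) \<in> F \<and> (j, \<beta>) \<in> F)}"
      by (rule finite_subset[OF _ finite_SigmaI[of "{w. c w \<noteq> 0}" splits2]]) (use c(1) in auto)
    show "finite {((i, \<alpha>), (j, \<beta>), u) | i \<alpha> j \<beta> u. (i, \<alpha>) \<in> F \<and> (j, \<beta>) \<in> F \<and> u \<in> U \<and> c (rev \<alpha> @ i # u @ j # \<beta>) = 0}"
      by (rule finite_subset[of _ "F \<times> F \<times> U"]) (use F(1) U(1) in auto)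
  qed (use U(2)[of _ "rev _", simplified] in \<open>auto simp: splits2_def ip_def\<close>)
  also have "\<dots> = (\<Sum>((i, \<alpha>), (j, \<beta>), u)\<in>F \<times> F \<times> U.
           c (rev \<alpha> @ i # u @ j # \<beta>) * ip J (f (i, \<alpha>)) (act J Z u (f (j, \<beta>))))"
    by (rule sum.cong) auto
  also have "\<dots> = (\<Sum>(i, \<alpha>)\<in>F. \<Sum>(j, \<beta>)\<in>F. \<Sum>u\<in>U.
           c (rev \<alpha> @ i # u @ j # \<beta>) * ip J (f (i, \<alpha>)) (act J Z u (f (j, \<beta>))))"
    by (simp add: sum.cartesian_product case_prod_unfold)
  finally show ?thesis .
qed

section \<open>Vanishing rows and scalar evaluations\<close>

lemma linear_nonneg_imp_zero:
  fixes A B :: real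
  assumes "\<And>s. 0 \<le> A + B * s"
  shows "B = 0"
proof (rule ccontr)
  assume "B \<noteq> 0"
  then have "A + B * (- (A + 1) / B) = - 1" by simp
  then show False using assms[of "- (A + 1) / B"] by linarith
qed

lemma quadratic_nonneg_imp_lead_nonneg:
  fixes A B C :: real
  assumes "\<And>s. 0 \<le> A + B * s + C * s\<^sup>2"
  shows "0 \<le> C"
proof (rule ccontr)
  assume C: "\<not> 0 \<le> C"
  define s where "s = sqrt ((\<bar>A\<bar> + 1) / - C)"
  have "s\<^sup>2 = (\<bar>A\<bar> + 1) / - C" using C by (simp add: s_def divide_nonneg_neg)
  then have "C * s\<^sup>2 = - (\<bar>A\<bar> + 1)" using C by simp
  then show False using assms[of s] assms[of "- s"] by simp
qed

lemma symmetric_coeffsD: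
  assumes "symmetric_coeffs c"
  shows "finite {w. c w \<noteq> 0}" "c (rev w) = c w"
  using assms by (auto simp: symmetric_coeffs_def)

lemma middle_words_finite:
  assumes "finite {w. c w \<noteq> 0}"
  shows "finite {u. c (\<alpha> @ i # u @ \<beta>) \<noteq> 0}"
proof -
  have "inj (\<lambda>u. \<alpha> @ i # u @ \<beta>)" by (simp add: inj_on_def)
  from finite_vimageI[OF assms this] show ?thesis by (simp add: vimage_def)
qed

text \<open>
  A positive semidefinite two by two block with vanishing first diagonal entry has vanishing
  off-diagonal entry. Evaluating at the tree, with a dual vector of \<open>u\<close> in the first row and the root
  in the second, turns that entry into the single coefficient of \<open>u\<close>.
\<close>

lemma middle_matrix_row_zero:
  fixes c :: "'v::finite list \<Rightarrow> real"
  assumes c: "symmetric_coeffs c" "midpoint_convex_in V c"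
    and V: "V i" "V j"
    and diag: "\<And>u. c (rev \<alpha> @ i # u @ i # \<alpha>) = 0"
  shows "c (rev \<alpha> @ i # u @ j # \<beta>) = 0"
proof (cases "(i, \<alpha>) = (j, \<beta>)")
  case False
  define M where "M = Max (insert (length u) (length ` {w. c w \<noteq> 0}))"
  have M: "length w \<le> M" if "c w \<noteq> 0 \<or> w = u" for w
    unfolding M_def by (rule Max_ge) (use that symmetric_coeffsD(1)[OF c(1)] in auto)
  let ?W = "words M :: 'v list set"
  have u: "u \<in> ?W" "rev u \<in> ?W" using M[of u] by (auto simp: words_def)
  obtain g :: "'v list \<Rightarrow> 'v list \<Rightarrow> real" where
    g: "\<forall>u\<in>?W. \<forall>w\<in>?W. ip ?W (g u) (act ?W tree w root_vec) = (if u = w then 1 else 0)"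
    using dual_vectors[of M] by blast
  \<comment> \<open>A free factor \<open>s\<close> on the first row, so that the form is affine in \<open>s\<close> with slope twice the entry.\<close>
  define f where "f s p = (if p = (i, \<alpha>) then (\<lambda>b. s * g u b) else root_vec)" for s and p :: "'v \<times> 'v list"
  have f: "f s (i, \<alpha>) = (\<lambda>b. s * g u b)" "f s (j, \<beta>) = root_vec" for s
    using False by (auto simp: f_def)
  let ?C = "\<Sum>u\<in>?W. c (rev \<beta> @ j # u @ j # \<beta>) * ip ?W root_vec (act ?W tree u root_vec)"
  let ?x = "c (rev \<alpha> @ i # u @ j # \<beta>)"
  have scale: "ip ?W (\<lambda>b. s * g u b) h = s * ip ?W (g u) h" for s h
    by (simp add: ip_def sum_distrib_left mult_ac)
  have 12: "(\<Sum>w\<in>?W. c (rev \<alpha> @ i # w @ j # \<beta>) * ip ?W (f s (i, \<alpha>)) (act ?W tree w (f s (j, \<beta>)))) = s * ?x" for s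
  proof -
    have "(\<Sum>w\<in>?W. c (rev \<alpha> @ i # w @ j # \<beta>) * ip ?W (f s (i, \<alpha>)) (act ?W tree w (f s (j, \<beta>)))) =
      (\<Sum>w\<in>?W. if w = u then s * ?x else 0)"
      by (rule sum.cong[OF refl]) (use u in \<open>simp add: f scale g\<close>)
    then show ?thesis using u by (simp add: sum.delta)
  qed
  have 21: "(\<Sum>w\<in>?W. c (rev \<beta> @ j # w @ i # \<alpha>) * ip ?W (f s (j, \<beta>)) (act ?W tree w (f s (i, \<alpha>)))) = s * ?x" for s
  proof -
    have "c (rev \<beta> @ j # rev u @ i # \<alpha>) = ?x"
      using symmetric_coeffsD(2)[OF c(1), of "rev \<alpha> @ i # u @ j # \<beta>"] by simp
    moreover have "ip ?W root_vec (act ?W tree w (\<lambda>b. s * g u b)) = (if w = rev u then s else 0)" if "w \<in> ?W" for w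
    proof -
      have "rev w \<in> ?W" using that by (simp add: words_def)
      then show ?thesis
        using u by (subst ip_act[OF symmetric_tree], subst ip_commute) (auto simp: scale g)
    qed
    ultimately have "(\<Sum>w\<in>?W. c (rev \<beta> @ j # w @ i # \<alpha>) * ip ?W (f s (j, \<beta>)) (act ?W tree w (f s (i, \<alpha>)))) =
      (\<Sum>w\<in>?W. if w = rev u then s * ?x else 0)"
      by (intro sum.cong[OF refl]) (simp add: f)
    then show ?thesis using u by (simp add: sum.delta)
  qed
  have "0 \<le> ?C + 2 * ?x * s" for s
  proof -
    have "0 \<le> (\<Sum>(i', \<alpha>')\<in>{(i, \<alpha>), (j, \<beta>)}. \<Sum>(j', \<beta>')\<in>{(i, \<alpha>), (j, \<beta>)}. \<Sum>u\<in>?W.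
           c (rev \<alpha>' @ i' # u @ j' # \<beta>') * ip ?W (f s (i', \<alpha>')) (act ?W tree u (f s (j', \<beta>'))))"
    proof (rule middle_matrix_nonneg[OF symmetric_coeffsD(1)[OF c(1)] c(2) finite_words symmetric_tree])
      fix i' \<alpha>' j' \<beta>' w assume "c (rev \<alpha>' @ i' # w @ j' # \<beta>') \<noteq> 0"
      with M[of "rev \<alpha>' @ i' # w @ j' # \<beta>'"] show "w \<in> ?W" by (simp add: words_def)
    qed (use V in auto)
    then show ?thesis
      using False by (simp add: 12 21 diag) (simp add: f algebra_simps)
  qed
  from linear_nonneg_imp_zero[OF this] show ?thesis by simp
qed (use diag in auto)

lemma act_scalar: "act {()} (\<lambda>v _ _. y v) u (\<lambda>_. a) = (\<lambda>_. prod_list (map y u) * a)"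
  by (induction u) (auto simp: mult_ac)

text \<open>
  The middle matrix evaluated at one by one matrices: the letter \<open>v\<close> becomes the real number \<open>y v\<close>.
\<close>

lemma middle_matrix_scalar:
  fixes c :: "'v::finite list \<Rightarrow> real"
  assumes c: "symmetric_coeffs c" "midpoint_convex_in V c"
    and F: "finite F" "\<And>i \<alpha>. (i, \<alpha>) \<in> F \<Longrightarrow> V i"
    and U: "finite U" "\<And>i \<alpha> j \<beta> u. (i, \<alpha>) \<in> F \<Longrightarrow> (j, \<beta>) \<in> F \<Longrightarrow> c (rev \<alpha> @ i # u @ j # \<beta>) \<noteq> 0 \<Longrightarrow> u \<in> U"
  shows "0 \<le> (\<Sum>(i, \<alpha>)\<in>F. \<Sum>(j, \<beta>)\<in>F. \<Sum>u\<in>U.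
           c (rev \<alpha> @ i # u @ j # \<beta>) * (a (i, \<alpha>) * (prod_list (map y u) * a (j, \<beta>))))"
proof -
  have "symmetric_kernel (\<lambda>v (_::unit) (_::unit). y v)" by (simp add: symmetric_kernel_def)
  from middle_matrix_nonneg[where f = "\<lambda>p _. a p" and J = "{()}", OF symmetric_coeffsD(1)[OF c(1)] c(2) _ this F U]
  show ?thesis by (simp add: act_scalar ip_def)
qed

lemma middle_diagonal_scalar:
  fixes c :: "'v::finite list \<Rightarrow> real"
  assumes c: "symmetric_coeffs c" "midpoint_convex_in V c" and "V i"
    and U: "finite U" "\<And>u. c (rev \<alpha> @ i # u @ i # \<alpha>) \<noteq> 0 \<Longrightarrow> u \<in> U"
  shows "0 \<le> (\<Sum>u\<in>U. c (rev \<alpha> @ i # u @ i # \<alpha>) * prod_list (map y u))"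
  using middle_matrix_scalar[OF c, of "{(i, \<alpha>)}" U "\<lambda>_. 1" y] assms by auto

section \<open>Convexity in some letters and concavity in the others\<close>

definition count_in :: "('v \<Rightarrow> bool) \<Rightarrow> 'v list \<Rightarrow> nat" where
  "count_in V w = length (filter V w)"

lemma count_in_simps [simp]:
  "count_in V [] = 0"
  "count_in V (v # w) = (if V v then Suc (count_in V w) else count_in V w)"
  "count_in V (u @ w) = count_in V u + count_in V w"
  "count_in V (rev w) = count_in V w"
  by (simp_all add: count_in_def flip: rev_filter)

lemma count_in_compl: "count_in V w + count_in (\<lambda>v. \<not> V v) w = length w"
  by (simp add: count_in_def sum_length_filter_compl)

lemma last_two_occurrences:
  assumes "2 \<le> count_in V w"
  obtains \<alpha> i u j \<beta> where "w = rev \<alpha> @ i # u @ j # \<beta>" "V i" "V j" "count_in V u = 0" "count_in V \<beta> = 0"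
proof -
  have ex: "\<exists>x y z. w = x @ y # z \<and> V y \<and> count_in V z = 0" if "0 < count_in V w" for w
  proof -
    have "\<exists>v\<in>set w. V v" using that by (auto simp: count_in_def filter_empty_conv)
    from split_list_last_prop[OF this] show ?thesis by (auto simp: count_in_def filter_empty_conv)
  qed
  from ex[of w] assms obtain x j \<beta> where 1: "w = x @ j # \<beta>" "V j" "count_in V \<beta> = 0" by auto
  with assms have "0 < count_in V x" by simp
  from ex[OF this] obtain y i u where "x = y @ i # u" "V i" "count_in V u = 0" by auto
  then show ?thesis using 1 that[of "rev y" i u j \<beta>] by simp
qed

text \<open>
  Take a word with the largest number \<open>d\<close> of letters in \<open>V\<close> and mark the last two. The words
  \<open>\<alpha>\<^sup>T i u i \<alpha>\<close> of the diagonal entry of its row contain at least \<open>2 (d - 2) + 2\<close> such letters, which is more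
  than \<open>d\<close> if \<open>d \<ge> 3\<close>. So the entry is zero, and with it the row.
\<close>

lemma convex_imp_count_le_2:
  fixes c :: "'v::finite list \<Rightarrow> real"
  assumes c: "symmetric_coeffs c" "midpoint_convex_in V c" and "c w \<noteq> 0"
  shows "count_in V w \<le> 2"
proof (rule ccontr)
  assume w: "\<not> count_in V w \<le> 2"
  let ?D = "count_in V ` {w. c w \<noteq> 0}"
  have fin: "finite ?D" using symmetric_coeffsD(1)[OF c(1)] by simp
  moreover have "?D \<noteq> {}" using assms by auto
  ultimately have "Max ?D \<in> ?D" by (rule Max_in)
  then obtain z where z: "c z \<noteq> 0" "count_in V z = Max ?D" by auto
  have max: "count_in V y \<le> count_in V z" if "c y \<noteq> 0" for y
    unfolding z(2) by (rule Max_ge[OF fin]) (use that in auto)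
  have "3 \<le> count_in V z" using max[OF assms(3)] w by linarith
  then have "2 \<le> count_in V z" by simp
  then obtain \<alpha> i u j \<beta> where s: "z = rev \<alpha> @ i # u @ j # \<beta>" "V i" "V j" "count_in V u = 0" "count_in V \<beta> = 0"
    by (rule last_two_occurrences)
  have "c (rev \<alpha> @ i # u' @ i # \<alpha>) = 0" for u'
    using max[of "rev \<alpha> @ i # u' @ i # \<alpha>"] s \<open>3 \<le> count_in V z\<close> by auto
  from middle_matrix_row_zero[OF c s(2,3) this] z(1) s(1) show False by blast
qed

lemma symmetric_coeffs_uminus:
  "symmetric_coeffs c \<Longrightarrow> symmetric_coeffs (\<lambda>w. - c w)"
  by (simp add: symmetric_coeffs_def)

locale convex_concave =
  fixes c :: "'v::finite list \<Rightarrow> real" and V :: "'v \<Rightarrow> bool"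
  assumes symmetric: "symmetric_coeffs c"
    and convex: "midpoint_convex_in V c"
    and concave: "midpoint_convex_in (\<lambda>v. \<not> V v) (\<lambda>w. - c w)"
begin

lemma swap: "convex_concave (\<lambda>w. - c w) (\<lambda>v. \<not> V v)"
  using symmetric convex concave
  by unfold_locales (simp_all add: symmetric_coeffs_uminus)

lemma count_le_2:
  assumes "c w \<noteq> 0"
  shows "count_in V w \<le> 2" "count_in (\<lambda>v. \<not> V v) w \<le> 2"
  using convex_imp_count_le_2[OF symmetric convex assms]
    convex_imp_count_le_2[OF symmetric_coeffs_uminus[OF symmetric] concave, of w] assms by auto

text \<open>
  The coefficient is a diagonal entry of the middle matrix for \<open>V\<close>, hence nonnegative. In the middle
  matrix for the other letters it is, with the opposite sign, the leading coefficient of a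
  nonnegative quadratic polynomial in the value \<open>s\<close> of the letter \<open>i\<close>.
\<close>

lemma sandwich_zero:
  assumes "V i" "\<not> V k"
  shows "c [k, i, i, k] = 0"
proof (rule antisym)
  \<comment> \<open>The outer letters already exhaust both degrees.\<close>
  have "u = []" if "c (rev [k] @ i # u @ i # [k]) \<noteq> 0" for u
    using count_le_2[OF that] assms count_in_compl[of V u] by simp
  then have "0 \<le> (\<Sum>u\<in>{[]}. c (rev [k] @ i # u @ i # [k]) * prod_list (map (\<lambda>_. 0) u))"
    by (intro middle_diagonal_scalar[OF symmetric convex assms(1)]) auto
  then  show "0 \<le> c [k, i, i, k]" by simp
next
  let ?U = "insert [] (insert [i] (insert [i, i] {u. c ([] @ k # u @ [k]) \<noteq> 0}))"
  have fin: "finite ?U" using middle_words_finite[OF symmetric_coeffsD(1)[OF symmetric]] by blast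
  have "0 \<le> - c [k, k] + (- c [k, i, k]) * s + (- c [k, i, i, k]) * s\<^sup>2" for s
  proof -
    define y where "y v = (if v = i then s else 0)" for v
    have "0 \<le> (\<Sum>u\<in>?U. - c (rev [] @ k # u @ k # []) * prod_list (map y u))"
      by (rule middle_diagonal_scalar[OF symmetric_coeffs_uminus[OF symmetric] concave])
        (use assms fin in auto)
    also have "\<dots> = (\<Sum>u\<in>{[], [i], [i, i]}. - c (k # u @ [k]) * prod_list (map y u))"
    \<comment> \<open>A middle word contributes only if it is a power of \<open>i\<close>, of exponent at most two by the degree bound.\<close>
    proof (rule sum.mono_neutral_cong_right[OF fin])
      show "\<forall>u\<in>?U - {[], [i], [i, i]}. - c (rev [] @ k # u @ k # []) * prod_list (map y u) = 0"
      proof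
        fix u assume u: "u \<in> ?U - {[], [i], [i, i]}"
        then have "c (k # u @ [k]) \<noteq> 0" by auto
        then have "count_in V u \<le> 2" "count_in (\<lambda>v. \<not> V v) u = 0"
          using count_le_2[of "k # u @ [k]"] assms(2) by auto
        then have "length u \<le> 2" using count_in_compl[of V u] by simp
        then have "\<not> (\<forall>v\<in>set u. v = i)"
          using u by (cases u; cases "tl u") auto
        then have "prod_list (map y u) = 0" by (auto simp: prod_list_zero_iff y_def)
        then show "- c (rev [] @ k # u @ k # []) * prod_list (map y u) = 0" by simp
      qed
    qed auto
    also have "\<dots> = - c [k, k] + (- c [k, i, k]) * s + (- c [k, i, i, k]) * s\<^sup>2"
      by (simp add: y_def power2_eq_square)
    finally show ?thesis .
  qed
  from quadratic_nonneg_imp_lead_nonneg[OF this] show "c [k, i, i, k] \<le> 0" by simp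
qed

text \<open>
  A nonempty prefix uses only letters outside \<open>V\<close>. By the degree bounds the diagonal entry of its row
  consists of at most one coefficient \<open>c [k, i, i, k]\<close>, which is zero.
\<close>

lemma prefix_empty:
  assumes "V i" "V j" "c (\<alpha> @ i # u @ j # \<beta>) \<noteq> 0"
  shows "\<alpha> = []"
proof (rule ccontr)
  assume "\<alpha> \<noteq> []"
  then obtain k \<alpha>' where \<alpha>: "rev \<alpha> = k # \<alpha>'" by (cases "rev \<alpha>") auto
  have "count_in V \<alpha> = 0" using count_le_2(1)[OF assms(3)] assms(1,2) by simp
  then have "count_in V (rev \<alpha>) = 0" by simp
  then have k: "\<not> V k" and \<alpha>': "count_in V \<alpha>' = 0" unfolding \<alpha> by (auto split: if_splits)
  have "c (rev (rev \<alpha>) @ i # u' @ i # rev \<alpha>) = 0" for u'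
  proof (rule ccontr)
    assume nz: "c (rev (rev \<alpha>) @ i # u' @ i # rev \<alpha>) \<noteq> 0"
    then have "count_in V u' = 0" "count_in (\<lambda>v. \<not> V v) u' = 0" "count_in (\<lambda>v. \<not> V v) \<alpha>' = 0"
      using count_le_2[OF nz] assms(1) k unfolding \<alpha> by auto
    then have "u' = []" "\<alpha>' = []" using count_in_compl[of V u'] count_in_compl[of V \<alpha>'] \<alpha>' by auto
    then show False using nz sandwich_zero[OF assms(1) k] unfolding \<alpha> by simp
  qed
  from middle_matrix_row_zero[OF symmetric convex assms(1,2) this] assms(3) show False by simp
qed

lemma prefix_suffix_empty:
  assumes "V i" "V j" "c (\<alpha> @ i # u @ j # \<beta>) \<noteq> 0"
  shows "\<alpha> = []" "\<beta> = []"
proof -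
  have "c (rev \<beta> @ j # rev u @ i # rev \<alpha>) \<noteq> 0"
    using symmetric_coeffsD(2)[OF symmetric, of "\<alpha> @ i # u @ j # \<beta>"] assms(3) by simp
  from prefix_empty[OF assms(2,1) this] show "\<beta> = []" by simp
qed (rule prefix_empty[OF assms])

text \<open>
  With two middle letters the word would also have degree two in the letters outside \<open>V\<close>. With the
  roles exchanged, \<open>prefix_suffix_empty\<close> would make it start outside \<open>V\<close>.
\<close>

lemma middle_length_le_1:
  assumes "V i" "V j" "c (i # u @ [j]) \<noteq> 0"
  shows "length u \<le> 1"
proof (rule ccontr)
  interpret swap: convex_concave "\<lambda>w. - c w" "\<lambda>v. \<not> V v" by (rule swap)
  assume "\<not> length u \<le> 1"
  moreover have "count_in V u = 0" using count_le_2(1)[OF assms(3)] assms(1,2) by simp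
  ultimately have "2 \<le> count_in (\<lambda>v. \<not> V v) (i # u @ [j])"
    using count_in_compl[of V u] by simp
  then obtain \<alpha> k z l \<beta> where s: "i # u @ [j] = rev \<alpha> @ k # z @ l # \<beta>" "\<not> V k" "\<not> V l"
    by (rule last_two_occurrences)
  have "rev \<alpha> = []"
    by (rule swap.prefix_suffix_empty(1)[of k l]) (use s assms(3) in auto)
  then show False using s assms(1) by simp
qed

lemma quadratic_form_scalar:
  assumes "finite U" "\<And>i j u. V i \<Longrightarrow> V j \<Longrightarrow> c (i # u @ [j]) \<noteq> 0 \<Longrightarrow> u \<in> U"
  shows "0 \<le> (\<Sum>i | V i. \<Sum>j | V j. \<Sum>u\<in>U. c (i # u @ [j]) * (a i * (prod_list (map y u) * a j)))"
proof -
  have "0 \<le> (\<Sum>(i, \<alpha>)\<in>(\<lambda>i. (i, [])) ` Collect V. \<Sum>(j, \<beta>)\<in>(\<lambda>i. (i, [])) ` Collect V. \<Sum>u\<in>U.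
           c (rev \<alpha> @ i # u @ j # \<beta>) * (a (fst (i, \<alpha>)) * (prod_list (map y u) * a (fst (j, \<beta>)))))"
    by (rule middle_matrix_scalar[OF symmetric convex]) (use assms in auto)
  then show ?thesis by (simp add: sum.reindex inj_on_def)
qed

text \<open>
  If \<open>k\<close> is given the value \<open>s\<close>, the quadratic form with matrix \<open>c [i, j] + s c [i, k, j]\<close> is nonnegative
  for every real \<open>s\<close>. So the form with matrix \<open>c [i, k, j]\<close> vanishes, and polarization gives its entries.
\<close>

lemma middle_letter_zero:
  assumes "V i" "V j"
  shows "c [i, k, j] = 0"
proof (cases "V k")
  case True
  then show ?thesis using count_le_2(1)[of "[i, k, j]"] assms by auto
next
  case False
  let ?U = "{u :: 'v list. length u \<le> 1}"
  have U: "?U = insert [] ((\<lambda>v. [v]) ` UNIV)" by (auto simp: le_Suc_eq length_Suc_conv)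
  then have finite_U: "finite ?U" by simp
  have "(\<Sum>i | V i. \<Sum>j | V j. c [i, k, j] * (a i * a j)) = 0" for a :: "'v \<Rightarrow> real"
  proof (rule linear_nonneg_imp_zero)
    fix s
    have "0 \<le> (\<Sum>i | V i. \<Sum>j | V j. \<Sum>u\<in>?U. c (i # u @ [j]) *
        (a i * (prod_list (map (\<lambda>v. if v = k then s else 0) u) * a j)))"
      using middle_length_le_1 by (intro quadratic_form_scalar finite_U) auto
    also have "\<dots> = (\<Sum>i | V i. \<Sum>j | V j. c [i, j] * (a i * a j) + c [i, k, j] * (a i * a j) * s)"
    proof (intro sum.cong refl)
      fix i j
      have "(\<Sum>v\<in>UNIV. c [i, v, j] * (a i * ((if v = k then s else 0) * a j))) =
          (\<Sum>v\<in>UNIV. if v = k then c [i, k, j] * (a i * (s * a j)) else 0)"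
        by (rule sum.cong) auto
      then show "(\<Sum>u\<in>?U. c (i # u @ [j]) * (a i * (prod_list (map (\<lambda>v. if v = k then s else 0) u) * a j)))
          = c [i, j] * (a i * a j) + c [i, k, j] * (a i * a j) * s"
        unfolding U by (subst sum.insert) (auto simp: sum.reindex inj_on_def sum.delta)
    qed
    finally show "0 \<le> (\<Sum>i | V i. \<Sum>j | V j. c [i, j] * (a i * a j)) +
        (\<Sum>i | V i. \<Sum>j | V j. c [i, k, j] * (a i * a j)) * s"
      by (simp add: sum.distrib sum_distrib_right)
  qed
  note * = this
  let ?d = "\<lambda>i v. if v = i then 1 else 0 :: real"
  have bil: "(\<Sum>x | V x. \<Sum>y | V y. c [x, k, y] * (?d p x * ?d q y)) = c [p, k, q]" if "V p" "V q" for p q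
  proof -
    have "(\<Sum>y | V y. c [x, k, y] * (?d p x * ?d q y)) = (if x = p then c [p, k, q] else 0)" for x
      using that sum.delta[of "Collect V" q "\<lambda>y. c [x, k, y] * ?d p x"]
      by (auto simp: if_distrib cong: if_cong)
    then show ?thesis using that by (simp add: sum.delta)
  qed
  \<comment> \<open>Polarization: the form vanishes at \<open>e\<^sub>i\<close>, \<open>e\<^sub>j\<close> and \<open>e\<^sub>i + e\<^sub>j\<close>.\<close>
  have "0 = (\<Sum>x | V x. \<Sum>y | V y. c [x, k, y] * ((?d i x + ?d j x) * (?d i y + ?d j y)))"
    by (rule *[symmetric])
  also have "\<dots> = (\<Sum>x | V x. \<Sum>y | V y. c [x, k, y] * (?d i x * ?d i y) + c [x, k, y] * (?d i x * ?d j y)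
      + c [x, k, y] * (?d j x * ?d i y) + c [x, k, y] * (?d j x * ?d j y))"
    by (intro sum.cong refl) (simp add: distrib_left distrib_right)
  also have "\<dots> = c [i, k, i] + c [i, k, j] + c [j, k, i] + c [j, k, j]"
    using assms by (simp only: sum.distrib bil)
  finally have "c [i, k, i] + c [i, k, j] + c [j, k, i] + c [j, k, j] = 0" by simp
  moreover have "c [i, k, i] = 0" "c [j, k, j] = 0"
    using *[of "?d i"] *[of "?d j"] bil assms by simp_all
  moreover have "c [j, k, i] = c [i, k, j]"
    using symmetric_coeffsD(2)[OF symmetric, of "[i, k, j]"] by simp
  ultimately show ?thesis by simp
qed

theorem quadratic_words:
  assumes "c w \<noteq> 0" "2 \<le> count_in V w"
  obtains i j where "w = [i, j]" "V i" "V j"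
proof -
  obtain \<alpha> i u j \<beta> where s: "w = rev \<alpha> @ i # u @ j # \<beta>" "V i" "V j"
    using assms(2) by (rule last_two_occurrences)
  then have "rev \<alpha> = []" "\<beta> = []" using prefix_suffix_empty[OF s(2,3)] assms(1) by auto
  then have w: "w = i # u @ [j]" using s by simp
  then have "length u \<le> 1" using middle_length_le_1[OF s(2,3)] assms(1) by simp
  moreover have "length u \<noteq> 1"
    using middle_letter_zero[OF s(2,3)] assms(1) w by (auto simp: length_Suc_conv)
  ultimately show ?thesis using that[of i j] w s by (cases u) auto
qed

theorem quadratic_form_nonneg: "0 \<le> (\<Sum>i | V i. \<Sum>j | V j. c [i, j] * (a i * a j))"
proof -
  have "0 \<le> (\<Sum>i | V i. \<Sum>j | V j. \<Sum>u\<in>{[]}. c (i # u @ [j]) * (a i * (prod_list (map (\<lambda>_. 0) u) * a j)))"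
  proof (rule quadratic_form_scalar)
    fix i j u assume ij: "V i" "V j" "c (i # u @ [j]) \<noteq> 0"
    from quadratic_words[OF ij(3)] ij show "u \<in> {[]}" by auto
  qed simp
  then show ?thesis by simp
qed

end

section \<open>Sums of squares of linear polynomials\<close>

text \<open>
  Completing the square one variable at a time: splitting off \<open>k\<close> leaves the Schur complement \<open>Q\<close>, whose
  values are those of \<open>P\<close> at the minimizing \<open>k\<close>-coordinate. If \<open>P k k = 0\<close>, nonnegativity makes the row of
  \<open>k\<close> zero, and the formulas stay correct because division by zero gives zero.
\<close>

lemma nonneg_form_sum_of_squares:
  fixes P :: "'v \<Rightarrow> 'v \<Rightarrow> real"
  assumes "finite S" "\<And>i j. P i j = P j i"
    and "\<And>a. 0 \<le> (\<Sum>i\<in>S. \<Sum>j\<in>S. P i j * (a i * a j))"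
  shows "\<exists>\<rho>s. \<forall>i\<in>S. \<forall>j\<in>S. P i j = (\<Sum>\<rho>\<leftarrow>\<rho>s. \<rho> i * \<rho> j)"
  using assms
proof (induction S arbitrary: P rule: finite_induct)
  case (insert k S)
  have form: "0 \<le> P k k * t\<^sup>2 + 2 * t * (\<Sum>j\<in>S. P k j * a j) + (\<Sum>i\<in>S. \<Sum>j\<in>S. P i j * (a i * a j))" for t a
  proof -
    define b where "b = a(k := t)"
    have b: "b k = t" "\<And>j. j \<in> S \<Longrightarrow> b j = a j" using insert.hyps(2) by (auto simp: b_def)
    have "0 \<le> (\<Sum>i\<in>insert k S. \<Sum>j\<in>insert k S. P i j * (b i * b j))" by (rule insert.prems(2))
    also have "\<dots> = P k k * t\<^sup>2 + (\<Sum>j\<in>S. P k j * (t * a j)) + (\<Sum>i\<in>S. P i k * (a i * t)) + (\<Sum>i\<in>S. \<Sum>j\<in>S. P i j * (a i * a j))"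
      using insert.hyps by (simp add: b sum.distrib power2_eq_square)
    also have "(\<Sum>i\<in>S. P i k * (a i * t)) = (\<Sum>j\<in>S. P k j * (t * a j))"
      by (rule sum.cong) (simp_all add: insert.prems(1)[of k] mult_ac)
    finally show ?thesis by (simp add: sum_distrib_left mult_ac)
  qed
  have kk: "0 \<le> P k k" using form[of 1 "\<lambda>_. 0"] by simp
  have zero: "P k i = 0" if "P k k = 0" "i \<in> S" for i
  proof -
    let ?d = "\<lambda>j. if j = i then 1 else 0 :: real"
    have "(\<Sum>j\<in>S. P k j * ?d j) = P k i"
      using that(2) insert.hyps(1) by (simp add: if_distrib sum.delta cong: if_cong)
    then have "0 \<le> (\<Sum>x\<in>S. \<Sum>y\<in>S. P x y * (?d x * ?d y)) + (2 * P k i) * t" for t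
      using form[of t ?d] that(1) by (simp add: mult_ac)
    from linear_nonneg_imp_zero[OF this] show ?thesis by simp
  qed
  define Q where "Q i j = P i j - P k i * P k j / P k k" for i j
  have "0 \<le> (\<Sum>i\<in>S. \<Sum>j\<in>S. Q i j * (a i * a j))" for a
  proof -
    let ?m = "\<Sum>j\<in>S. P k j * a j"
    have "(\<Sum>i\<in>S. \<Sum>j\<in>S. Q i j * (a i * a j)) =
        (\<Sum>i\<in>S. \<Sum>j\<in>S. P i j * (a i * a j)) - (\<Sum>i\<in>S. \<Sum>j\<in>S. (P k i * a i) * (P k j * a j)) / P k k"
      by (simp add: Q_def algebra_simps sum_subtractf sum_divide_distrib)
    also have "(\<Sum>i\<in>S. \<Sum>j\<in>S. (P k i * a i) * (P k j * a j)) = ?m\<^sup>2"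
      by (simp add: power2_eq_square sum_product)
    also have "(\<Sum>i\<in>S. \<Sum>j\<in>S. P i j * (a i * a j)) - ?m\<^sup>2 / P k k =
        P k k * (- ?m / P k k)\<^sup>2 + 2 * (- ?m / P k k) * ?m + (\<Sum>i\<in>S. \<Sum>j\<in>S. P i j * (a i * a j))"
      by (cases "P k k = 0") (simp_all add: power2_eq_square)
    also have "0 \<le> \<dots>" by (rule form)
    finally show ?thesis .
  qed
  moreover have "Q i j = Q j i" for i j using insert.prems(1)[of i j] by (simp add: Q_def mult.commute)
  ultimately obtain \<rho>s where \<rho>s: "\<forall>i\<in>S. \<forall>j\<in>S. Q i j = (\<Sum>\<rho>\<leftarrow>\<rho>s. \<rho> i * \<rho> j)"
    using insert.IH[of Q] by blast
  define \<rho>0 where "\<rho>0 i = P k i / sqrt (P k k)" for i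
  have sq: "\<rho>0 i * \<rho>0 j = P k i * P k j / P k k" for i j
    using kk by (simp add: \<rho>0_def)
  let ?\<rho>s = "\<rho>0 # map (\<lambda>\<rho>. \<rho>(k := 0)) \<rho>s"
  have "P i j = (\<Sum>\<rho>\<leftarrow>?\<rho>s. \<rho> i * \<rho> j)" if "i \<in> insert k S" "j \<in> insert k S" for i j
  proof (cases "i \<in> S \<and> j \<in> S")
    case True
    then have "i \<noteq> k" "j \<noteq> k" using insert.hyps(2) by auto
    then have "(\<Sum>\<rho>\<leftarrow>?\<rho>s. \<rho> i * \<rho> j) = P k i * P k j / P k k + Q i j"
      using True \<rho>s by (simp add: sq comp_def)
    then show ?thesis by (simp add: Q_def)
  next
    case False
    then have "i = k \<or> j = k" using that by auto
    then have "(\<Sum>\<rho>\<leftarrow>?\<rho>s. \<rho> i * \<rho> j) = P k i * P k j / P k k"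
      by (auto simp: sq comp_def)
    then show ?thesis
      using \<open>i = k \<or> j = k\<close> that zero insert.prems(1)[of i k] by (cases "P k k = 0") auto
  qed
  then show ?case by blast
qed simp

context convex_concave
begin

text \<open>
  The square roots are cut off outside \<open>V\<close>, so that they become linear polynomials in the letters of \<open>V\<close>
  only and their Gram sum has no further words.
\<close>

lemma quadratic_coefficients_gram:
  "\<exists>\<rho>s. (\<forall>\<rho>\<in>set \<rho>s. \<forall>v. \<not> V v \<longrightarrow> \<rho> v = 0) \<and>
     (\<forall>i j. (\<Sum>\<rho>\<leftarrow>\<rho>s. \<rho> i * \<rho> j) = (if V i \<and> V j then c [i, j] else 0))"
proof -
  have "\<exists>\<rho>s. \<forall>i\<in>Collect V. \<forall>j\<in>Collect V. c [i, j] = (\<Sum>\<rho>\<leftarrow>\<rho>s. \<rho> i * \<rho> j)"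
  proof (rule nonneg_form_sum_of_squares)
    fix i j show "c [i, j] = c [j, i]" using symmetric_coeffsD(2)[OF symmetric, of "[i, j]"] by simp
  qed (simp_all add: quadratic_form_nonneg)
  then obtain \<rho>s where \<rho>s: "\<forall>i\<in>Collect V. \<forall>j\<in>Collect V. c [i, j] = (\<Sum>\<rho>\<leftarrow>\<rho>s. \<rho> i * \<rho> j)" by blast
  let ?\<rho>s = "map (\<lambda>\<rho> v. if V v then \<rho> v else 0) \<rho>s"
  have "(\<Sum>\<rho>\<leftarrow>?\<rho>s. \<rho> i * \<rho> j) = (if V i \<and> V j then c [i, j] else 0)" for i j
    using \<rho>s by (auto simp: comp_def)
  then show ?thesis by (intro exI[of _ ?\<rho>s]) auto
qed

end

instance var :: (finite) finite
proof
  have "(UNIV :: 'a var set) = range AVar \<union> range XVar"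
    by (metis UNIV_eq_I Un_iff rangeI var.exhaust)
  moreover have "finite (range AVar \<union> range XVar :: 'a var set)" by simp
  ultimately show "finite (UNIV :: 'a var set)" by metis
qed

definition coeffs_of :: "'g ncpoly \<Rightarrow> 'g var list \<Rightarrow> real" where
  "coeffs_of p w = Poly_Mapping.lookup p (Word w)"

definition linear_poly :: "('g::finite var \<Rightarrow> real) \<Rightarrow> 'g ncpoly" where
  "linear_poly \<rho> = (\<Sum>v\<in>UNIV. Poly_Mapping.single (Word [v]) (\<rho> v))"

lemma lookup_linear_poly:
  "Poly_Mapping.lookup (linear_poly \<rho>) (Word w) = (case w of [v] \<Rightarrow> \<rho> v | _ \<Rightarrow> 0)"
proof -
  have "Poly_Mapping.lookup (linear_poly \<rho>) (Word w) = (\<Sum>v\<in>UNIV. if w = [v] then \<rho> v else 0)"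
    by (simp add: linear_poly_def lookup_sum lookup_single when_def eq_commute)
  also have "\<dots> = (case w of [v] \<Rightarrow> \<rho> v | _ \<Rightarrow> 0)"
    by (auto split: list.split simp: sum.delta)
  finally show ?thesis .
qed

lemma linear_in_linear_poly:
  assumes "\<And>v. \<not> V v \<Longrightarrow> \<rho> v = 0"
  shows "linear_in V (linear_poly \<rho>)"
  unfolding linear_in_def
proof
  fix w assume "w \<in> Poly_Mapping.keys (linear_poly \<rho>)"
  moreover obtain vs where "w = Word vs" by (cases w)
  ultimately show "\<exists>v. V v \<and> w = Word [v]"
    using assms by (auto simp: in_keys_iff lookup_linear_poly split: list.splits)
qed

lemma nc_transpose_linear_poly: "nc_transpose (linear_poly \<rho>) = linear_poly \<rho>"
proof (rule poly_mapping_eqI)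
  fix w :: "'a var word"
  obtain vs where "w = Word vs" by (cases w)
  then show "Poly_Mapping.lookup (nc_transpose (linear_poly \<rho>)) w = Poly_Mapping.lookup (linear_poly \<rho>) w"
    by (cases vs; cases "tl vs") (auto simp: lookup_nc_transpose lookup_linear_poly split: list.split)
qed

lemma lookup_linear_poly_square:
  "Poly_Mapping.lookup (linear_poly \<rho> * linear_poly \<rho>) (Word w) = (case w of [i, j] \<Rightarrow> \<rho> i * \<rho> j | _ \<Rightarrow> 0)"
proof -
  have "Poly_Mapping.lookup (linear_poly \<rho> * linear_poly \<rho>) (Word w) =
      (\<Sum>i\<in>UNIV. \<Sum>j\<in>UNIV. if w = [i, j] then \<rho> i * \<rho> j else 0)"
    by (simp add: linear_poly_def sum_product mult_single plus_word_def lookup_sum lookup_single when_def eq_commute)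
  also have "\<dots> = (case w of [i, j] \<Rightarrow> \<rho> i * \<rho> j | _ \<Rightarrow> 0)"
  proof -
    have "(\<Sum>i\<in>UNIV. \<Sum>j\<in>UNIV. if w = [i, j] then \<rho> i * \<rho> j else 0) = \<rho> a * \<rho> b" if "w = [a, b]" for a b
    proof -
      have "(\<Sum>j\<in>UNIV. if w = [i, j] then \<rho> i * \<rho> j else 0) = (if i = a then \<rho> a * \<rho> b else 0)" for i
        using that sum.delta[of UNIV b "\<lambda>j. \<rho> i * \<rho> j"] by (auto simp: eq_commute)
      then show ?thesis by (simp add: sum.delta)
    qed
    moreover have "(\<Sum>i\<in>UNIV. \<Sum>j\<in>UNIV. if w = [i, j] then \<rho> i * \<rho> j else 0) = 0" if "length w \<noteq> 2"
      using that by (intro sum.neutral ballI) auto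
    ultimately show ?thesis by (auto split: list.split)
  qed
  finally show ?thesis .
qed

lemma lookup_nc_gram_linear:
  "Poly_Mapping.lookup (nc_gram (map linear_poly \<rho>s)) (Word w) =
     (case w of [i, j] \<Rightarrow> (\<Sum>\<rho>\<leftarrow>\<rho>s. \<rho> i * \<rho> j) | _ \<Rightarrow> 0)"
  by (induction \<rho>s)
    (auto simp: nc_gram_def lookup_add nc_transpose_linear_poly lookup_linear_poly_square split: list.split)

text \<open>
  Since every word of degree at least two in \<open>V\<close> that occurs is a product of two letters of \<open>V\<close>, the sum
  of squares reproduces the whole part of \<open>p\<close> of degree at least two in \<open>V\<close>.
\<close>

lemma convex_concave_gram:
  fixes p :: "'g::finite ncpoly"
  assumes "convex_concave (coeffs_of p) V"
  obtains R where "\<And>r. r \<in> set R \<Longrightarrow> linear_in V r"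
    and "\<And>w. Poly_Mapping.lookup (nc_gram R) (Word w) = (if 2 \<le> count_in V w then coeffs_of p w else 0)"
proof -
  interpret convex_concave "coeffs_of p" V by fact
  obtain \<rho>s where \<rho>s: "\<forall>\<rho>\<in>set \<rho>s. \<forall>v. \<not> V v \<longrightarrow> \<rho> v = 0"
      "\<And>i j. (\<Sum>\<rho>\<leftarrow>\<rho>s. \<rho> i * \<rho> j) = (if V i \<and> V j then coeffs_of p [i, j] else 0)"
    using quadratic_coefficients_gram by blast
  show ?thesis
  proof
    show "linear_in V r" if "r \<in> set (map linear_poly \<rho>s)" for r
      using that \<rho>s(1) by (auto intro: linear_in_linear_poly)
    show "Poly_Mapping.lookup (nc_gram (map linear_poly \<rho>s)) (Word w) =
        (if 2 \<le> count_in V w then coeffs_of p w else 0)" for w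
    proof (cases "2 \<le> count_in V w \<and> coeffs_of p w \<noteq> 0")
      case True
      then obtain i j where "w = [i, j]" "V i" "V j" using quadratic_words by blast
      then show ?thesis using True by (simp add: lookup_nc_gram_linear \<rho>s(2))
    next
      case False
      then show ?thesis
        by (auto simp: lookup_nc_gram_linear \<rho>s(2) split: list.split)
    qed
  qed
qed

section \<open>Matrices and kernels\<close>

definition kernel_mat :: "nat \<Rightarrow> (nat \<Rightarrow> nat \<Rightarrow> real) \<Rightarrow> real mat" where
  "kernel_mat n k = mat n n (\<lambda>(a, b). k a b)"

definition eval_kernel :: "nat \<Rightarrow> 'g ncpoly \<Rightarrow> ('g var \<Rightarrow> nat \<Rightarrow> nat \<Rightarrow> real) \<Rightarrow> real mat" where
  "eval_kernel n p K = eval_nc n p (\<lambda>i. kernel_mat n (K (AVar i))) (\<lambda>i. kernel_mat n (K (XVar i)))"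

lemma sym_tuple_kernel_mat:
  "symmetric_kernel K \<Longrightarrow> sym_tuple n (\<lambda>i. kernel_mat n (K (h i)))"
  by (auto simp: sym_tuple_def kernel_mat_def symmetric_kernel_def intro!: eq_matI)

lemma tuple_comb_kernel_mat:
  "tuple_comb (1 / 2) (\<lambda>i. kernel_mat n (\<lambda>r s. K (h i) r s + H (h i) r s)) (\<lambda>i. kernel_mat n (\<lambda>r s. K (h i) r s - H (h i) r s)) =
     (\<lambda>i. kernel_mat n (K (h i)))"
  by (auto simp: tuple_comb_def kernel_mat_def fun_eq_iff field_simps intro!: eq_matI)

lemma eval_word_kernel_mat:
  fixes n :: nat and K :: "'g var \<Rightarrow> nat \<Rightarrow> nat \<Rightarrow> real"
  defines "E \<equiv> \<lambda>w. eval_word n (\<lambda>i. kernel_mat n (K (AVar i))) (\<lambda>i. kernel_mat n (K (XVar i))) (Word w)"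
  shows "E w \<in> carrier_mat n n \<and> (\<forall>a<n. (\<Sum>b<n. E w $$ (a, b) * f b) = act {..<n} K w f a)"
proof (induction w)
  case Nil
  have "(\<Sum>b<n. 1\<^sub>m n $$ (a, b) * f b) = (\<Sum>b<n. if b = a then f a else 0)" if "a < n" for a
    by (rule sum.cong) (use that in auto)
  then show ?case by (auto simp: E_def eval_word_def)
next
  case (Cons v w)
  have E: "E (v # w) = kernel_mat n (K v) * E w"
    by (cases v) (simp_all add: E_def eval_word_def)
  have entry: "E (v # w) $$ (a, b) = (\<Sum>s<n. K v a s * E w $$ (s, b))" if "a < n" "b < n" for a b
    using that Cons.IH unfolding E
    by (auto simp: kernel_mat_def scalar_prod_def atLeast0LessThan intro!: sum.cong)
  have "(\<Sum>b<n. E (v # w) $$ (a, b) * f b) = act {..<n} K (v # w) f a" if "a < n" for a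
  proof -
    have "(\<Sum>b<n. E (v # w) $$ (a, b) * f b) = (\<Sum>b<n. \<Sum>s<n. K v a s * (E w $$ (s, b) * f b))"
      by (rule sum.cong) (simp_all add: entry that sum_distrib_left sum_distrib_right mult_ac)
    also have "\<dots> = (\<Sum>s<n. K v a s * (\<Sum>b<n. E w $$ (s, b) * f b))"
      unfolding sum_distrib_left by (rule sum.swap)
    also have "\<dots> = act {..<n} K (v # w) f a" using Cons.IH by simp
    finally show ?thesis .
  qed
  moreover have "E (v # w) \<in> carrier_mat n n" using Cons.IH unfolding E by (auto simp: kernel_mat_def)
  ultimately show ?case by blast
qed

definition mat_form :: "nat \<Rightarrow> real mat \<Rightarrow> (nat \<Rightarrow> real) \<Rightarrow> real" where
  "mat_form n M f = (\<Sum>a<n. \<Sum>b<n. f a * M $$ (a, b) * f b)"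

lemma mat_form_eval_kernel: "mat_form n (eval_kernel n p K) f = form {..<n} (coeffs_of p) K f"
proof -
  let ?E = "\<lambda>w. eval_word n (\<lambda>i. kernel_mat n (K (AVar i))) (\<lambda>i. kernel_mat n (K (XVar i))) w"
  have keys: "Poly_Mapping.keys p = Word ` {w. coeffs_of p w \<noteq> 0}"
    by (auto simp: coeffs_of_def in_keys_iff image_iff) (metis word.exhaust)
  have "mat_form n (eval_kernel n p K) f =
      (\<Sum>a<n. \<Sum>b<n. \<Sum>w\<in>Poly_Mapping.keys p. Poly_Mapping.lookup p w * (f a * (?E w $$ (a, b) * f b)))"
    by (simp add: mat_form_def eval_kernel_def eval_nc_def sum_distrib_left sum_distrib_right mult_ac)
  also have "\<dots> = (\<Sum>a<n. \<Sum>w\<in>Poly_Mapping.keys p. \<Sum>b<n. Poly_Mapping.lookup p w * (f a * (?E w $$ (a, b) * f b)))"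
    by (intro sum.cong refl sum.swap)
  also have "\<dots> = (\<Sum>w\<in>Poly_Mapping.keys p. \<Sum>a<n. \<Sum>b<n. Poly_Mapping.lookup p w * (f a * (?E w $$ (a, b) * f b)))"
    by (rule sum.swap)
  also have "\<dots> = (\<Sum>w | coeffs_of p w \<noteq> 0. coeffs_of p w * (\<Sum>a<n. f a * (\<Sum>b<n. ?E (Word w) $$ (a, b) * f b)))"
    by (simp add: keys sum.reindex inj_on_def coeffs_of_def sum_distrib_left)
  also have "\<dots> = form {..<n} (coeffs_of p) K f"
    using eval_word_kernel_mat[of n K] by (simp add: form_def ip_def)
  finally show ?thesis .
qed

lemma eval_kernel_carrier: "eval_kernel n p K \<in> carrier_mat n n"
  by (simp add: eval_kernel_def eval_nc_def)

lemma mat_ge_imp_mat_form_le: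
  assumes "mat_ge n P Q" "P \<in> carrier_mat n n" "Q \<in> carrier_mat n n"
  shows "mat_form n Q f \<le> mat_form n P f"
proof -
  have "0 \<le> vec n f \<bullet> ((P - Q) *\<^sub>v vec n f)"
    using assms(1) by (simp add: mat_ge_def pos_semidef_def)
  also have "\<dots> = (\<Sum>a<n. f a * (\<Sum>b<n. (P - Q) $$ (a, b) * f b))"
    using assms(2,3) by (simp add: scalar_prod_def atLeast0LessThan mult_mat_vec_def)
  also have "\<dots> = mat_form n P f - mat_form n Q f"
    using assms(2,3) by (simp add: mat_form_def sum_distrib_left left_diff_distrib right_diff_distrib sum_subtractf mult_ac)
  finally show ?thesis by simp
qed

lemma mat_form_mean:
  assumes "P \<in> carrier_mat n n" "Q \<in> carrier_mat n n"
  shows "mat_form n ((1 / 2) \<cdot>\<^sub>m P + (1 / 2) \<cdot>\<^sub>m Q) f = (mat_form n P f + mat_form n Q f) / 2"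
  using assms by (simp add: mat_form_def sum.distrib distrib_left distrib_right sum_divide_distrib add_divide_distrib)

lemma mean_carrier:
  assumes "P \<in> carrier_mat n n" "Q \<in> carrier_mat n n"
  shows "(1 / 2) \<cdot>\<^sub>m P + (1 / 2) \<cdot>\<^sub>m Q \<in> carrier_mat n n"
  using assms by auto

text \<open>
  The kernels \<open>K + H\<close> and \<open>K - H\<close> give matrix tuples with the same \<open>a\<close>-part and with midpoint \<open>K\<close>; the
  matrix inequality at weight \<open>1/2\<close> is tested against one vector.
\<close>

lemma convex_in_x_imp_midpoint_convex:
  assumes "convex_in_x p"
  shows "midpoint_convex_in is_x (coeffs_of p)"
  unfolding midpoint_convex_in_def
proof (intro allI impI)
  fix n :: nat and K H :: "'a var \<Rightarrow> nat \<Rightarrow> nat \<Rightarrow> real" and f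
  assume K: "symmetric_kernel K" and H: "symmetric_kernel H" and 0: "\<forall>v. \<not> is_x v \<longrightarrow> H v = (\<lambda>_ _. 0)"
  let ?P = "\<lambda>v r s. K v r s + H v r s" and ?M = "\<lambda>v r s. K v r s - H v r s"
  have PM: "symmetric_kernel ?P" "symmetric_kernel ?M" using K H by (auto simp: symmetric_kernel_def)
  have A: "H (AVar i) = (\<lambda>_ _. 0)" for i using 0 by (simp add: is_x_def)
  have "mat_ge n ((1 / 2) \<cdot>\<^sub>m eval_kernel n p ?P + (1 / 2) \<cdot>\<^sub>m eval_kernel n p ?M) (eval_kernel n p K)"
    using assms[unfolded convex_in_x_def, rule_format, OF sym_tuple_kernel_mat[OF K] sym_tuple_kernel_mat[OF PM(1)] sym_tuple_kernel_mat[OF PM(2)],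
        of "1 / 2" n AVar XVar XVar]
    by (simp add: eval_kernel_def A tuple_comb_kernel_mat[of n K XVar H])
  from mat_ge_imp_mat_form_le[OF this mean_carrier[OF eval_kernel_carrier eval_kernel_carrier] eval_kernel_carrier, of f]
  show "2 * form {..<n} (coeffs_of p) K f \<le> form {..<n} (coeffs_of p) ?P f + form {..<n} (coeffs_of p) ?M f"
    by (simp add: mat_form_mean[OF eval_kernel_carrier eval_kernel_carrier] mat_form_eval_kernel del: One_nat_def)
qed

lemma form_uminus: "form I (\<lambda>w. - c w) K f = - form I c K f"
  by (simp add: form_def sum_negf)

lemma concave_in_a_imp_midpoint_convex:
  assumes "concave_in_a p"
  shows "midpoint_convex_in is_a (\<lambda>w. - coeffs_of p w)"
  unfolding midpoint_convex_in_def
proof (intro allI impI)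
  fix n :: nat and K H :: "'a var \<Rightarrow> nat \<Rightarrow> nat \<Rightarrow> real" and f
  assume K: "symmetric_kernel K" and H: "symmetric_kernel H" and 0: "\<forall>v. \<not> is_a v \<longrightarrow> H v = (\<lambda>_ _. 0)"
  let ?P = "\<lambda>v r s. K v r s + H v r s" and ?M = "\<lambda>v r s. K v r s - H v r s"
  have PM: "symmetric_kernel ?P" "symmetric_kernel ?M" using K H by (auto simp: symmetric_kernel_def)
  have X: "H (XVar i) = (\<lambda>_ _. 0)" for i using 0 by (simp add: is_a_def)
  have "mat_ge n (eval_kernel n p K) ((1 / 2) \<cdot>\<^sub>m eval_kernel n p ?P + (1 / 2) \<cdot>\<^sub>m eval_kernel n p ?M)"
    using assms[unfolded concave_in_a_def, rule_format, OF sym_tuple_kernel_mat[OF PM(1)] sym_tuple_kernel_mat[OF PM(2)] sym_tuple_kernel_mat[OF K],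
        of "1 / 2" n AVar AVar XVar]
    by (simp add: eval_kernel_def X tuple_comb_kernel_mat[of n K AVar H])
  from mat_ge_imp_mat_form_le[OF this eval_kernel_carrier mean_carrier[OF eval_kernel_carrier eval_kernel_carrier], of f]
  show "2 * form {..<n} (\<lambda>w. - coeffs_of p w) K f \<le>
      form {..<n} (\<lambda>w. - coeffs_of p w) ?P f + form {..<n} (\<lambda>w. - coeffs_of p w) ?M f"
    by (simp add: form_uminus mat_form_mean[OF eval_kernel_carrier eval_kernel_carrier] mat_form_eval_kernel del: One_nat_def)
qed

lemma symmetric_coeffs_of:
  assumes "nc_symmetric p"
  shows "symmetric_coeffs (coeffs_of p)"
proof -
  have "finite {w. coeffs_of p w \<noteq> 0}"
    using finite_vimageI[of "Poly_Mapping.keys p" Word]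
    by (simp add: inj_on_def coeffs_of_def vimage_def in_keys_iff)
  moreover have "coeffs_of p (rev w) = coeffs_of p w" for w
    using lookup_nc_transpose[of p "Word w"] assms by (simp add: nc_symmetric_def coeffs_of_def)
  ultimately show ?thesis by (simp add: symmetric_coeffs_def)
qed

lemma degree_in_le_1I:
  assumes "\<And>w. Poly_Mapping.lookup p (Word w) \<noteq> 0 \<Longrightarrow> count_in V w \<le> 1"
  shows "degree_in V p \<le> 1"
proof -
  have "length (filter V (letters w)) \<le> 1" if "w \<in> Poly_Mapping.keys p" for w
    using assms[of "letters w"] that by (simp add: in_keys_iff count_in_def)
  then show ?thesis by (simp add: degree_in_def)
qed

section \<open>The structure theorem\<close>

lemma not_is_x: "(\<lambda>v. \<not> is_x v) = is_a"
  by (auto simp: fun_eq_iff is_x_def is_a_def intro: var.exhaust)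

theorem theorem1p6:
  fixes p :: "'g::finite ncpoly"
  assumes "nc_symmetric p"
    and "convex_in_x p"
    and "concave_in_a p"
  shows "\<exists>(R :: 'g ncpoly list) (S :: 'g ncpoly list) (L :: 'g ncpoly).
           (\<forall>r\<in>set R. linear_in is_x r) \<and>
           (\<forall>s\<in>set S. linear_in is_a s) \<and>
           degree_in is_x L \<le> 1 \<and> degree_in is_a L \<le> 1 \<and>
           p = L + nc_gram R - nc_gram S"
proof -
  interpret x: convex_concave "coeffs_of p" is_x
    by unfold_locales
      (simp_all add: symmetric_coeffs_of convex_in_x_imp_midpoint_convex concave_in_a_imp_midpoint_convex assms not_is_x)
  have neg: "(\<lambda>w. - coeffs_of p w) = coeffs_of (- p)"
    by (simp add: coeffs_of_def fun_eq_iff)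
  have a: "convex_concave (coeffs_of (- p)) is_a"
    using x.swap unfolding neg not_is_x .
  obtain R where R: "\<And>r. r \<in> set R \<Longrightarrow> linear_in is_x r"
      "\<And>w. Poly_Mapping.lookup (nc_gram R) (Word w) = (if 2 \<le> count_in is_x w then coeffs_of p w else 0)"
    by (rule convex_concave_gram[OF x.convex_concave_axioms]) blast
  obtain S where S: "\<And>s. s \<in> set S \<Longrightarrow> linear_in is_a s"
      "\<And>w. Poly_Mapping.lookup (nc_gram S) (Word w) = (if 2 \<le> count_in is_a w then coeffs_of (- p) w else 0)"
    by (rule convex_concave_gram[OF a]) blast
  define L where "L = p - nc_gram R + nc_gram S"
  have L: "count_in is_x w \<le> 1 \<and> count_in is_a w \<le> 1" if "Poly_Mapping.lookup L (Word w) \<noteq> 0" for w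
  proof -
    have eq: "Poly_Mapping.lookup L (Word w) = coeffs_of p w - (if 2 \<le> count_in is_x w then coeffs_of p w else 0)
        - (if 2 \<le> count_in is_a w then coeffs_of p w else 0)"
      by (simp add: L_def lookup_add lookup_minus R(2) S(2) flip: neg) (simp add: coeffs_of_def)
    with that have nz: "coeffs_of p w \<noteq> 0" by (auto split: if_splits)
    \<comment> \<open>A word of degree two in one kind of letters has no letters of the other kind, so each such word is
      cancelled by exactly one of the two Gram sums.\<close>
    have "count_in is_a w = 0" if two: "2 \<le> count_in is_x w"
    proof -
      obtain i j where "w = [i, j]" "is_x i" "is_x j" by (rule x.quadratic_words[OF nz two])
      then show ?thesis by (simp flip: not_is_x)
    qed
    then show ?thesis using eq that by (auto split: if_splits)
  qed
  have "p = L + nc_gram R - nc_gram S" by (simp add: L_def)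
  moreover have "degree_in is_x L \<le> 1" "degree_in is_a L \<le> 1"
    using L by (blast intro: degree_in_le_1I)+
  ultimately show ?thesis using R(1) S(1) by blast
qed

end
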